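(* Let $K$ be a commutative ring, $\delta,\delta_e,\kappa\in K$ with $\delta_e$ invertible, and $m\ge 1$. The map $\rho^-$ extends $K$-linearly to an algebra isomorphism $$\rho^-:\ \frac{\mathbf e'}{\delta_e}\, b'_{2m}(\delta,\delta_e,\kappa)\,\frac{\mathbf e'}{\delta_e}\ \longrightarrow\ b'_{2m-2}(\delta,\kappa,\delta_e).$$
   Context: A Temperley--Lieb (TL) diagram on $n$ vertices is a non-crossing pairing of vertices $1,\dots,n$ (left to right on the northern edge of a rectangle) and $1',\dots,n'$ (left to right on the southern edge), realised by disjoint lines inside the rectangle, up to isotopy. $J^B_{2m}$ is the set of TL diagrams on $2m$ vertices invariant under reflection in the central vertical line. Diagrams $d_1,d_2$ are concatenated by stacking (a symmetric picture of) $d_1$ above $d_2$. Regions of the picture are two-coloured black/white, regions on two sides of a line having different colours, with the region touching the northern interval between vertices $m$ and $m+1$ white. For $\alpha,\beta,\gamma\in K$, $b'_{2m}(\alpha,\beta,\gamma)$ is the free $K$-module on $J^B_{2m}$ with product $d_1d_2=\alpha^{l_0}\beta^{l_w}\gamma^{l_b}c$, where $c$ is the diagram obtained from the concatenation by deleting closed loops, $l_0$ is the number of mirror pairs of closed loops not crossing the centre line, and $l_w$ (resp. $l_b$) is the number of closed loops crossing the centre line whose immediate interior is white (resp. black). $\mathbf e'\in J^B_{2m}$ is the diagram that differs from the identity $\{\{i,i'\}\}_{i=1}^{2m}$ only in having the pairs $\{m,m+1\},\{m',(m+1)'\}$; it satisfies $\mathbf e'\mathbf e'=\delta_e\mathbf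 e'$ in $b'_{2m}(\delta,\delta_e,\kappa)$, so $\mathbf e'/\delta_e$ is idempotent. The algebra $\frac{\mathbf e'}{\delta_e}b'_{2m}\frac{\mathbf e'}{\delta_e}$ has basis the set $J^{Be}_{2m}$ of elements $\frac1{\delta_e}d$, where $d\in J^B_{2m}$ contains both pairs $\{m,m+1\}$ and $\{m',(m+1)'\}$. The map $\rho^-:J^{Be}_{2m}\to J^B_{2m-2}$ sends $\frac1{\delta_e}d$ to the diagram obtained from $d$ by deleting the pairs $\{m,m+1\}$, $\{m',(m+1)'\}$ and their vertices and renumbering; it is a bijection. *)

theory Defs
  imports "HOL-Algebra.Module" "HOL-Algebra.QuotRing" "HOL-Library.FuncSet"
begin

text \<open>
  Diagrams have vertices in the rows \<open>North\<close> and \<open>South\<close>; the row \<open>Middle\<close> only occurs in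
  concatenations, where the southern edge of the upper diagram is glued to the northern edge of the
  lower one. A diagram is its set of lines, each line being the set of its two end points (up to
  isotopy a diagram is determined by this pairing).
\<close>

datatype row = North | Middle | South

type_synonym vertex = "row \<times> nat"
type_synonym diagram = "vertex set set"

definition vertices :: "nat \<Rightarrow> vertex set" where
  "vertices n = {North, South} \<times> {1..n}"

text \<open>Clockwise position on the boundary of the rectangle, starting at the north-west corner.\<close>

fun boundary_pos :: "nat \<Rightarrow> vertex \<Rightarrow> nat" where
  "boundary_pos n (r, i) = (if r = North then i else 2 * n + 1 - i)"

definition pairing :: "nat \<Rightarrow> diagram \<Rightarrow> bool" where
  "pairing n d \<longleftrightarrow> \<Union> d = vertices n \<and> (\<forall>l\<in>d. card l = 2) \<and>
     (\<forall>l\<in>d. \<forall>l'\<in>d. l \<noteq> l' \<longrightarrow> l \<inter> l' = {})"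

definition non_crossing :: "nat \<Rightarrow> diagram \<Rightarrow> bool" where
  "non_crossing n d \<longleftrightarrow>
     (\<forall>a b a' b'. {a, b} \<in> d \<longrightarrow> {a', b'} \<in> d \<longrightarrow>
        \<not> (boundary_pos n a < boundary_pos n a' \<and> boundary_pos n a' < boundary_pos n b \<and>
           boundary_pos n b < boundary_pos n b'))"

definition TL :: "nat \<Rightarrow> diagram set" where
  "TL n = {d. pairing n d \<and> non_crossing n d}"

definition map_diagram :: "(vertex \<Rightarrow> vertex) \<Rightarrow> diagram \<Rightarrow> diagram" where
  "map_diagram f d = (\<lambda>l. f ` l) ` d"

text \<open>Below, \<open>m\<close> is half the number of vertices on an edge: the centre line runs between the
  vertices \<open>m\<close> and \<open>m + 1\<close> of each row.\<close>

fun mirror :: "nat \<Rightarrow> vertex \<Rightarrow> vertex" where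
  "mirror m (r, i) = (r, 2 * m + 1 - i)"

definition JB :: "nat \<Rightarrow> diagram set" where
  "JB m = {d \<in> TL (2 * m). map_diagram (mirror m) d = d}"

definition upper :: "vertex \<Rightarrow> vertex" where
  "upper = (\<lambda>(r, i). (if r = South then Middle else r, i))"

definition lower :: "vertex \<Rightarrow> vertex" where
  "lower = (\<lambda>(r, i). (if r = North then Middle else r, i))"

definition stack :: "diagram \<Rightarrow> diagram \<Rightarrow> vertex set set" where
  "stack d1 d2 = map_diagram upper d1 \<union> map_diagram lower d2"

definition connected_in :: "vertex set set \<Rightarrow> (vertex \<times> vertex) set" where
  "connected_in E = {(x, y). {x, y} \<in> E}\<^sup>*"

text \<open>The concatenation without its closed loops: every open path of the stacked picture joins two
  vertices of the outer edges.\<close>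

definition compose :: "nat \<Rightarrow> diagram \<Rightarrow> diagram \<Rightarrow> diagram" where
  "compose m d1 d2 =
     {{x, y} | x y. x \<in> vertices (2 * m) \<and> y \<in> vertices (2 * m) \<and> x \<noteq> y \<and>
        (x, y) \<in> connected_in (stack d1 d2)}"

text \<open>A closed loop, given by the set of vertices it runs through, all of them on the middle line.\<close>

definition loops :: "nat \<Rightarrow> diagram \<Rightarrow> diagram \<Rightarrow> vertex set set" where
  "loops m d1 d2 =
     {L. \<exists>i\<in>{1..2 * m}. L = connected_in (stack d1 d2) `` {(Middle, i)} \<and> L \<subseteq> {Middle} \<times> UNIV}"

text \<open>Up to isotopy, a loop meets the centre line iff it has vertices on both sides of it.\<close>

definition crosses_centre :: "nat \<Rightarrow> vertex set \<Rightarrow> bool" where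
  "crosses_centre m L \<longleftrightarrow> (\<exists>v\<in>L. snd v \<le> m) \<and> (\<exists>v\<in>L. m < snd v)"

text \<open>
  Gap \<open>j\<close> of a row is the interval between its vertices \<open>j\<close> and \<open>j + 1\<close>. A path inside the
  upper diagram \<open>d\<close> from gap \<open>m\<close> of its northern edge to gap \<open>j\<close> of its southern edge (the middle
  line of the concatenation) has to cross exactly those lines which have one end point on either
  side of it. The colour changes at each crossing and the starting region is white.
\<close>

definition right_of :: "nat \<Rightarrow> nat \<Rightarrow> vertex set" where
  "right_of m j = {North} \<times> {m<..} \<union> {South} \<times> {j<..}"

definition white_gap :: "nat \<Rightarrow> diagram \<Rightarrow> nat \<Rightarrow> bool" where
  "white_gap m d j \<longleftrightarrow>
     even (card {l \<in> d. l \<inter> right_of m j \<noteq> {} \<and> \<not> l \<subseteq> right_of m j})"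

text \<open>Immediately to the right of its leftmost vertex one is in the interior of a loop.\<close>

definition interior_white :: "nat \<Rightarrow> diagram \<Rightarrow> vertex set \<Rightarrow> bool" where
  "interior_white m d1 L \<longleftrightarrow> white_gap m d1 (Min (snd ` L))"

definition loops_pairs :: "nat \<Rightarrow> diagram \<Rightarrow> diagram \<Rightarrow> nat" where
  "loops_pairs m d1 d2 =
     card {{L, mirror m ` L} | L. L \<in> loops m d1 d2 \<and> \<not> crosses_centre m L}"

definition loops_white :: "nat \<Rightarrow> diagram \<Rightarrow> diagram \<Rightarrow> nat" where
  "loops_white m d1 d2 =
     card {L \<in> loops m d1 d2. crosses_centre m L \<and> interior_white m d1 L}"

definition loops_black :: "nat \<Rightarrow> diagram \<Rightarrow> diagram \<Rightarrow> nat" where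
  "loops_black m d1 d2 =
     card {L \<in> loops m d1 d2. crosses_centre m L \<and> \<not> interior_white m d1 L}"

definition id_diagram :: "nat \<Rightarrow> diagram" where
  "id_diagram m = {{(North, i), (South, i)} | i. i \<in> {1..2 * m}}"

text \<open>The basis vector of the free module on \<open>JB m\<close> belonging to the diagram \<open>d\<close>.\<close>

definition basis :: "('k, 'r) ring_scheme \<Rightarrow> nat \<Rightarrow> diagram \<Rightarrow> diagram \<Rightarrow> 'k" where
  "basis K m d = (\<lambda>c\<in>JB m. if c = d then \<one>\<^bsub>K\<^esub> else \<zero>\<^bsub>K\<^esub>)"

definition loop_factor ::
  "('k, 'r) ring_scheme \<Rightarrow> nat \<Rightarrow> 'k \<Rightarrow> 'k \<Rightarrow> 'k \<Rightarrow> diagram \<Rightarrow> diagram \<Rightarrow> 'k" where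
  "loop_factor K m \<alpha> \<beta> \<gamma> d1 d2 =
     \<alpha> [^]\<^bsub>K\<^esub> loops_pairs m d1 d2 \<otimes>\<^bsub>K\<^esub> \<beta> [^]\<^bsub>K\<^esub> loops_white m d1 d2 \<otimes>\<^bsub>K\<^esub> \<gamma> [^]\<^bsub>K\<^esub> loops_black m d1 d2"

text \<open>The algebra on \<open>2 * m\<close> vertices; the multiplication is the bilinear extension of
  \<open>d1 d2 = loop_factor d1 d2 * compose d1 d2\<close>.\<close>

definition b_alg ::
  "('k, 'r) ring_scheme \<Rightarrow> nat \<Rightarrow> 'k \<Rightarrow> 'k \<Rightarrow> 'k \<Rightarrow> ('k, diagram \<Rightarrow> 'k) module" where
  "b_alg K m \<alpha> \<beta> \<gamma> =
    \<lparr>carrier = JB m \<rightarrow>\<^sub>E carrier K,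
     mult = (\<lambda>f g. \<lambda>c\<in>JB m.
       \<Oplus>\<^bsub>K\<^esub>p \<in> {(d1, d2). d1 \<in> JB m \<and> d2 \<in> JB m \<and> compose m d1 d2 = c}.
         f (fst p) \<otimes>\<^bsub>K\<^esub> g (snd p) \<otimes>\<^bsub>K\<^esub> loop_factor K m \<alpha> \<beta> \<gamma> (fst p) (snd p)),
     one = basis K m (id_diagram m),
     zero = (\<lambda>c\<in>JB m. \<zero>\<^bsub>K\<^esub>),
     add = (\<lambda>f g. \<lambda>c\<in>JB m. f c \<oplus>\<^bsub>K\<^esub> g c),
     smult = (\<lambda>a f. \<lambda>c\<in>JB m. a \<otimes>\<^bsub>K\<^esub> f c)\<rparr>"

definition corner :: "('k, 'a) module \<Rightarrow> 'a \<Rightarrow> ('k, 'a) module" where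
  "corner A e = A\<lparr>carrier := {e \<otimes>\<^bsub>A\<^esub> x \<otimes>\<^bsub>A\<^esub> e | x. x \<in> carrier A}, one := e\<rparr>"

definition algebra_iso ::
  "('k, 'r) ring_scheme \<Rightarrow> ('k, 'a) module \<Rightarrow> ('k, 'b) module \<Rightarrow> ('a \<Rightarrow> 'b) set" where
  "algebra_iso K A B =
     {h \<in> ring_iso A B. \<forall>a\<in>carrier K. \<forall>x\<in>carrier A. h (a \<odot>\<^bsub>A\<^esub> x) = a \<odot>\<^bsub>B\<^esub> h x}"

definition cup_cap :: "nat \<Rightarrow> diagram" where
  "cup_cap m = {{(North, m), (North, m + 1)}, {(South, m), (South, m + 1)}}"

definition e_diagram :: "nat \<Rightarrow> diagram" where
  "e_diagram m =
     (id_diagram m - {{(North, m), (South, m)}, {(North, m + 1), (South, m + 1)}}) \<union> cup_cap m"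

definition JBe :: "nat \<Rightarrow> diagram set" where
  "JBe m = {d \<in> JB m. cup_cap m \<subseteq> d}"

fun renumber :: "nat \<Rightarrow> vertex \<Rightarrow> vertex" where
  "renumber m (r, i) = (r, if i < m then i else i - 2)"

definition rho :: "nat \<Rightarrow> diagram \<Rightarrow> diagram" where
  "rho m d = map_diagram (renumber m) (d - cup_cap m)"

end

theory Submission
  imports Defs
begin

text \<open>
  A diagram with the pairs of \<open>cup_cap m\<close> arises from exactly one diagram \<open>c\<close> with two columns fewer, by
  inserting the columns \<open>m\<close> and \<open>m + 1\<close> and joining them by a cup and a cap; this is \<open>add_cups m c\<close>, and
  \<open>add_cups m\<close> is the inverse of \<open>rho m\<close>. It commutes with everything that is defined by the shape of a
  diagram: with the non-crossing condition, because a cup or cap joins neighbours on the boundary, and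
  with the reflection, because the new columns lie symmetrically.

  Stack \<open>add_cups m c1\<close> on \<open>add_cups m c2\<close>. In each of the three rows the vertices \<open>m\<close> and \<open>m + 1\<close> are
  joined to each other and to nothing else. So the picture is that of \<open>c1\<close> on \<open>c2\<close> together with three
  separate links: the outer two are the cup and the cap of the product (\<open>compose_add_cups\<close>), and the
  middle one is a small closed loop across the centre line (\<open>loops_add_cups\<close>).

  The colour of gap \<open>j\<close> on the middle line is a parity: it is white iff \<open>m + j\<close> is even
  (\<open>white_gap_iff_even\<close>). The small loop starts at vertex \<open>m\<close>, so it is white. Any other loop across the
  centre line has its leftmost vertex to the left of \<open>m\<close>. This vertex keeps its number while \<open>m\<close> drops
  by one, so removing the two columns turns white loops black and black loops white. Mirror pairs of
  loops off the centre line are preserved. Altogether the scalar of \<open>add_cups m c1\<close> and \<open>add_cups m c2\<close>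
  is \<open>\<beta>\<close> times the scalar of \<open>c1\<close> and \<open>c2\<close> with \<open>\<beta>\<close> and \<open>\<gamma>\<close> exchanged (\<open>loop_factor_add_cups\<close>).
  With \<open>\<beta> = \<delta>\<^sub>e\<close> the extra factor is the one that the normalisation \<open>d / \<delta>\<^sub>e\<close> of the basis absorbs, and
  the linear extension of \<open>d / \<delta>\<^sub>e \<mapsto> rho m d\<close> is multiplicative.

  The corner consists of the coefficient functions supported on \<open>JBe m\<close>. A product inherits the northern
  cup of its upper factor and the southern cap of its lower factor, which bounds the corner from above.
  Conversely, \<open>f = e f e\<close> for such \<open>f\<close>, because the injective multiplicative map just described sends \<open>e\<close>
  to the identity diagram, which is neutral for the multiplication on \<open>2 * (m - 1)\<close> vertices.
\<close>

section \<open>Inserting a cup and a cap at the centre\<close>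

text \<open>
  A section of \<open>renumber m\<close>. Unlike \<open>renumber m\<close> it is injective on all vertices, which is why
  everything below is phrased by inserting columns and not by deleting them.
\<close>

fun shift :: "nat \<Rightarrow> vertex \<Rightarrow> vertex" where
  "shift m (r, i) = (r, if i < m then i else i + 2)"

definition add_cups :: "nat \<Rightarrow> diagram \<Rightarrow> diagram" where
  "add_cups m c = cup_cap m \<union> map_diagram (shift m) c"

lemma renumber_shift [simp]: "renumber m (shift m v) = v"
  by (cases v) auto

lemma inj_shift: "inj (shift m)"
  by (metis injI renumber_shift)

lemma shift_eq_iff [simp]: "shift m v = shift m w \<longleftrightarrow> v = w"
  by (metis renumber_shift)

lemma shift_image_eq_iff [simp]: "shift m ` X = shift m ` Y \<longleftrightarrow> X = Y"
  by (simp add: inj_image_eq_iff inj_shift)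

lemma map_diagram_shift_eq_iff [simp]:
  "map_diagram (shift m) c = map_diagram (shift m) c' \<longleftrightarrow> c = c'"
  unfolding map_diagram_def by (rule inj_image_eq_iff) (simp add: inj_def)

lemma shift_renumber: "snd v \<notin> {m, m + 1} \<Longrightarrow> shift m (renumber m v) = v"
  by (cases v) auto

lemma snd_shift: "snd (shift m v) = (if snd v < m then snd v else snd v + 2)"
  by (cases v) auto

lemma snd_shift_neq [simp]: "snd (shift m v) \<noteq> m" "snd (shift m v) \<noteq> Suc m"
  by (auto simp: snd_shift)

declare shift.simps [simp del]

lemma shift_neq_centre [simp]:
  "shift m v \<noteq> (r, m)" "shift m v \<noteq> (r, Suc m)" "(r, m) \<noteq> shift m v" "(r, Suc m) \<noteq> shift m v"
  using snd_shift_neq[of m v] by (metis snd_conv)+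

lemma centre_notin_shift_image [simp]: "(r, m) \<notin> shift m ` X" "(r, Suc m) \<notin> shift m ` X"
  by auto

lemma cup_cap_shift_disjoint: "cup_cap m \<inter> map_diagram (shift m) c = {}"
  by (force simp: cup_cap_def map_diagram_def)

lemma add_cups_eq_iff [simp]: "add_cups m c = add_cups m c' \<longleftrightarrow> c = c'"
  using cup_cap_shift_disjoint[of m c] cup_cap_shift_disjoint[of m c']
    map_diagram_shift_eq_iff[of m c c'] unfolding add_cups_def by blast

lemma rho_add_cups [simp]: "rho m (add_cups m c) = c"
proof -
  have "add_cups m c - cup_cap m = map_diagram (shift m) c"
    using cup_cap_shift_disjoint[of m c] by (auto simp: add_cups_def)
  then show ?thesis
    by (simp add: rho_def map_diagram_def image_image)
qed

lemma index_image_shift: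
  fixes m :: nat
  assumes "m \<ge> 1"
  shows "(\<lambda>i. if i < m then i else i + 2) ` {1..2 * (m - 1)} = {1..2 * m} - {m, m + 1}"
    (is "?f ` _ = _")
proof
  show "?f ` {1..2 * (m - 1)} \<subseteq> {1..2 * m} - {m, m + 1}"
    using assms by auto
  show "{1..2 * m} - {m, m + 1} \<subseteq> ?f ` {1..2 * (m - 1)}"
  proof
    fix i assume i: "i \<in> {1..2 * m} - {m, m + 1}"
    show "i \<in> ?f ` {1..2 * (m - 1)}"
      by (rule image_eqI[of _ _ "if i < m then i else i - 2"]) (use i in auto)
  qed
qed

lemma shift_image_times:
  assumes "m \<ge> 1"
  shows "shift m ` (X \<times> {1..2 * (m - 1)}) = X \<times> ({1..2 * m} - {m, m + 1})"
proof -
  have "shift m = map_prod id (\<lambda>i. if i < m then i else i + 2)"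
    by (auto simp: fun_eq_iff shift.simps)
  then show ?thesis
    using index_image_shift[OF assms] by (simp add: map_prod_surj_on)
qed

lemma vertices_shift:
  assumes "m \<ge> 1"
  shows "vertices (2 * m) = {North, South} \<times> {m, m + 1} \<union> shift m ` vertices (2 * (m - 1))"
  unfolding vertices_def shift_image_times[OF assms] using assms by auto

lemma shift_in_vertices [simp]:
  assumes "m \<ge> 1"
  shows "shift m v \<in> vertices (2 * m) \<longleftrightarrow> v \<in> vertices (2 * (m - 1))"
  using vertices_shift[OF assms] by auto

lemma shift_line_in_add_cups: "l \<in> c \<Longrightarrow> shift m ` l \<in> add_cups m c"
  by (auto simp: add_cups_def map_diagram_def)

lemma Union_add_cups: "\<Union> (add_cups m c) = {North, South} \<times> {m, m + 1} \<union> shift m ` \<Union> c"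
  by (auto simp: add_cups_def cup_cap_def map_diagram_def)

lemma pairing_disjoint: "pairing n d \<Longrightarrow> l \<in> d \<Longrightarrow> k \<in> d \<Longrightarrow> l \<noteq> k \<Longrightarrow> l \<inter> k = {}"
  by (simp add: pairing_def)

lemma pairing_subset: "pairing n d \<Longrightarrow> l \<in> d \<Longrightarrow> l \<subseteq> vertices n"
  by (auto simp: pairing_def)

text \<open>
  The new lines use up exactly the vertices that \<open>shift m\<close> misses, and they are disjoint from each other
  and from the shifted lines.
\<close>

lemma pairing_add_cups:
  assumes "m \<ge> 1"
  shows "pairing (2 * m) (add_cups m c) \<longleftrightarrow> pairing (2 * (m - 1)) c"
proof -
  let ?C = "{North, South} \<times> {m, m + 1}"
  have cancel: "A \<union> X = A \<union> Y \<longleftrightarrow> X = Y" if "A \<inter> X = {}" "A \<inter> Y = {}" for A X Y :: "vertex set"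
    using that by blast
  have disj: "?C \<inter> shift m ` X = {}" for X
    by auto
  have "?C \<union> shift m ` X = ?C \<union> shift m ` Y \<longleftrightarrow> shift m ` X = shift m ` Y" for X Y
    by (rule cancel) (rule disj)+
  then have "\<Union> (add_cups m c) = vertices (2 * m) \<longleftrightarrow> \<Union> c = vertices (2 * (m - 1))"
    unfolding Union_add_cups vertices_shift[OF assms] shift_image_eq_iff .
  moreover have "(\<forall>l\<in>add_cups m c. card l = 2) \<longleftrightarrow> (\<forall>l\<in>c. card l = 2)"
    by (auto simp: add_cups_def cup_cap_def map_diagram_def card_image inj_on_subset[OF inj_shift])
  moreover have "(\<forall>l\<in>add_cups m c. \<forall>l'\<in>add_cups m c. l \<noteq> l' \<longrightarrow> l \<inter> l' = {}) \<longleftrightarrow>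
      (\<forall>l\<in>c. \<forall>l'\<in>c. l \<noteq> l' \<longrightarrow> l \<inter> l' = {})"
    by (auto simp: add_cups_def cup_cap_def map_diagram_def
        image_Int[OF inj_shift, symmetric])
  ultimately show ?thesis
    by (simp only: pairing_def)
qed

text \<open>
  Going round the boundary, two positions are skipped on the northern edge and two on the southern
  edge. So \<open>shift m\<close> adds 0, 2 or 4 to a position, and never less to a later one.
\<close>

lemma boundary_pos_shift:
  assumes "m \<ge> 1" "v \<in> vertices (2 * (m - 1))" "w \<in> vertices (2 * (m - 1))"
  shows "boundary_pos (2 * m) (shift m v) < boundary_pos (2 * m) (shift m w) \<longleftrightarrow>
    boundary_pos (2 * (m - 1)) v < boundary_pos (2 * (m - 1)) w"
  using assms by (cases v; cases w) (auto simp: vertices_def shift.simps split: if_splits)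

lemma in_add_cups_cases:
  assumes "{a, b} \<in> add_cups m c"
  obtains (cup) r where "{a, b} = {(r, m), (r, m + 1)}" "r \<noteq> Middle"
  | (old) v w where "a = shift m v" "b = shift m w" "{v, w} \<in> c"
proof -
  consider r where "{a, b} = {(r, m), (r, m + 1)}" "r \<noteq> Middle"
    | l where "l \<in> c" "{a, b} = shift m ` l"
    using assms by (auto simp: add_cups_def cup_cap_def map_diagram_def)
  then show thesis
  proof cases
    case 1
    then show ?thesis by (rule cup)
  next
    case 2
    then obtain v w where vw: "a = shift m v" "b = shift m w" by blast
    then have "shift m ` l = shift m ` {v, w}" using 2 by simp
    then have "l = {v, w}" by (rule shift_image_eq_iff[THEN iffD1])
    then show ?thesis using old vw 2 by blast
  qed
qed

text \<open>
  The reason why the new lines cross nothing: no position lies between their end points.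
\<close>

lemma cup_boundary_pos:
  assumes "m \<ge> 1" "{a, b} = {(r, m), (r, m + 1)}" "boundary_pos (2 * m) a < boundary_pos (2 * m) b"
  shows "boundary_pos (2 * m) b = boundary_pos (2 * m) a + 1"
  using assms by (auto simp: doubleton_eq_iff split: if_splits)

lemma non_crossing_add_cups:
  assumes "m \<ge> 1" "pairing (2 * (m - 1)) c"
  shows "non_crossing (2 * m) (add_cups m c) \<longleftrightarrow> non_crossing (2 * (m - 1)) c"
proof
  have vert: "v \<in> vertices (2 * (m - 1))" "w \<in> vertices (2 * (m - 1))" if "{v, w} \<in> c" for v w
    using assms(2) that unfolding pairing_def by blast+
  let ?p = "boundary_pos (2 * m)" and ?q = "boundary_pos (2 * (m - 1))"
  {
    assume nc: "non_crossing (2 * m) (add_cups m c)"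
    have "\<not> (?q a < ?q a' \<and> ?q a' < ?q b \<and> ?q b < ?q b')" if c: "{a, b} \<in> c" "{a', b'} \<in> c" for a b a' b'
    proof -
      have "{shift m a, shift m b} \<in> add_cups m c" "{shift m a', shift m b'} \<in> add_cups m c"
        using c[THEN shift_line_in_add_cups, of m] by simp_all
      then have "\<not> (?p (shift m a) < ?p (shift m a') \<and> ?p (shift m a') < ?p (shift m b) \<and>
          ?p (shift m b) < ?p (shift m b'))"
        using nc unfolding non_crossing_def by blast
      then show ?thesis
        using boundary_pos_shift[OF assms(1)] vert c by metis
    qed
    then show "non_crossing (2 * (m - 1)) c"
      unfolding non_crossing_def by blast
  }
  assume nc: "non_crossing (2 * (m - 1)) c"
  have "\<not> (?p a < ?p a' \<and> ?p a' < ?p b \<and> ?p b < ?p b')"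
    if c: "{a, b} \<in> add_cups m c" "{a', b'} \<in> add_cups m c" for a b a' b'
    using c(1)
  proof (cases rule: in_add_cups_cases)
    case cup
    then show ?thesis using cup_boundary_pos[OF assms(1) cup(1)] by linarith
  next
    case ab: (old v w)
    from c(2) show ?thesis
    proof (cases rule: in_add_cups_cases)
      case cup
      then show ?thesis using cup_boundary_pos[OF assms(1) cup(1)] by linarith
    next
      case (old v' w')
      have "\<not> (?q v < ?q v' \<and> ?q v' < ?q w \<and> ?q w < ?q w')"
        using nc ab(3) old(3) unfolding non_crossing_def by blast
      then show ?thesis
        unfolding ab(1,2) old(1,2) using boundary_pos_shift[OF assms(1)] vert ab(3) old(3) by metis
    qed
  qed
  then show "non_crossing (2 * m) (add_cups m c)"
    unfolding non_crossing_def by blast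
qed

lemma mirror_shift: "m \<ge> 1 \<Longrightarrow> mirror m (shift m v) = shift m (mirror (m - 1) v)"
  by (cases v) (auto simp: shift.simps)

lemma mirror_add_cups:
  assumes "m \<ge> 1"
  shows "map_diagram (mirror m) (add_cups m c) = add_cups m (map_diagram (mirror (m - 1)) c)"
proof -
  have "map_diagram (mirror m) (cup_cap m) = cup_cap m"
    using assms by (auto simp: map_diagram_def cup_cap_def insert_commute)
  moreover have "map_diagram (mirror m) (map_diagram (shift m) c) =
      map_diagram (shift m) (map_diagram (mirror (m - 1)) c)"
    by (simp add: map_diagram_def image_image mirror_shift[OF assms])
  ultimately show ?thesis
    by (simp add: add_cups_def map_diagram_def image_Un)
qed

lemma add_cups_in_JB_iff:
  assumes "m \<ge> 1"
  shows "add_cups m c \<in> JB m \<longleftrightarrow> c \<in> JB (m - 1)"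
proof (cases "pairing (2 * (m - 1)) c")
  case True
  then show ?thesis
    by (simp only: JB_def TL_def mem_Collect_eq pairing_add_cups[OF assms]
        non_crossing_add_cups[OF assms] mirror_add_cups[OF assms] add_cups_eq_iff)
next
  case False
  then show ?thesis
    by (simp only: JB_def TL_def mem_Collect_eq pairing_add_cups[OF assms] simp_thms)
qed

text \<open>
  A diagram in \<open>JBe m\<close> is recovered from its image under \<open>rho m\<close>: its lines are disjoint, so those
  outside \<open>cup_cap m\<close> avoid the columns \<open>m\<close> and \<open>m + 1\<close>, where \<open>shift m\<close> undoes \<open>renumber m\<close>.
\<close>

lemma JBe_eq_add_cups:
  assumes "m \<ge> 1"
  shows "JBe m = add_cups m ` JB (m - 1)"
proof
  show "add_cups m ` JB (m - 1) \<subseteq> JBe m"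
    using add_cups_in_JB_iff[OF assms] by (auto simp: JBe_def add_cups_def)
  show "JBe m \<subseteq> add_cups m ` JB (m - 1)"
  proof
    fix d assume "d \<in> JBe m"
    then have d: "d \<in> JB m" "cup_cap m \<subseteq> d" and pair: "pairing (2 * m) d"
      by (auto simp: JBe_def JB_def TL_def)
    have "shift m ` renumber m ` l = l" if l: "l \<in> d - cup_cap m" for l
    proof -
      have "\<forall>k\<in>cup_cap m. l \<inter> k = {}"
        using pairing_disjoint[OF pair] d(2) l by blast
      moreover have "l \<subseteq> {North, South} \<times> UNIV"
        using pairing_subset[OF pair] l by (auto simp: vertices_def)
      ultimately have "\<forall>v\<in>l. snd v \<notin> {m, m + 1}"
        by (auto simp: cup_cap_def)
      then have "\<forall>v\<in>l. shift m (renumber m v) = v"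
        using shift_renumber by blast
      then show ?thesis
        by (simp add: image_image)
    qed
    then have "map_diagram (shift m) (rho m d) = d - cup_cap m"
      by (simp add: map_diagram_def rho_def image_image)
    then have "add_cups m (rho m d) = d"
      using d(2) by (auto simp: add_cups_def)
    then show "d \<in> add_cups m ` JB (m - 1)"
      using d(1) add_cups_in_JB_iff[OF assms] by (metis image_eqI)
  qed
qed

lemma pairing_line:
  assumes "pairing n d" "l \<in> d"
  obtains a b where "l = {a, b}" "a \<noteq> b" "a \<in> vertices n" "b \<in> vertices n"
  using assms unfolding pairing_def by (metis UnionI card_2_iff insertI1 insertI2 )

lemma pairing_id_diagram: "pairing (2 * m) (id_diagram m)"
proof -
  have "id_diagram m = (\<lambda>i. {(North, i), (South, i)}) ` {1..2 * m}"
    by (auto simp: id_diagram_def)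
  then show ?thesis
    by (auto simp: pairing_def vertices_def)
qed

lemma id_diagram_in_JB: "id_diagram m \<in> JB m"
proof -
  have "non_crossing (2 * m) (id_diagram m)"
    unfolding non_crossing_def by (auto simp: id_diagram_def doubleton_eq_iff)
  moreover have "map_diagram (mirror m) (id_diagram m) = id_diagram m"
  proof -
    have refl: "(\<lambda>i. 2 * m + 1 - i) ` {1..2 * m} = {1..2 * m}"
    proof
      show "{1..2 * m} \<subseteq> (\<lambda>i. 2 * m + 1 - i) ` {1..2 * m}"
      proof
        fix i assume i: "i \<in> {1..2 * m}"
        show "i \<in> (\<lambda>i. 2 * m + 1 - i) ` {1..2 * m}"
          by (rule image_eqI[of _ _ "2 * m + 1 - i"]) (use i in auto)
      qed
    qed auto
    have "id_diagram m = (\<lambda>i. {(North, i), (South, i)}) ` {1..2 * m}"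
      by (auto simp: id_diagram_def)
    moreover have "map_diagram (mirror m) ((\<lambda>i. {(North, i), (South, i)}) ` {1..2 * m})
        = (\<lambda>i. {(North, i), (South, i)}) ` (\<lambda>i. 2 * m + 1 - i) ` {1..2 * m}"
      by (simp add: map_diagram_def image_image)
    ultimately show ?thesis
      unfolding refl by simp
  qed
  ultimately show ?thesis
    using pairing_id_diagram by (simp add: JB_def TL_def)
qed

lemma e_diagram_eq_add_cups:
  assumes "m \<ge> 1"
  shows "e_diagram m = add_cups m (id_diagram (m - 1))"
proof -
  let ?line = "\<lambda>i. {(North, i :: nat), (South, i)}"
  have img: "id_diagram n = ?line ` {1..2 * n}" for n
    by (auto simp: id_diagram_def)
  have "map_diagram (shift m) (id_diagram (m - 1)) =
      ?line ` (\<lambda>i. if i < m then i else i + 2) ` {1..2 * (m - 1)}"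
    unfolding img map_diagram_def image_image
    by (rule image_cong) (simp_all add: shift.simps)
  also have "\<dots> = ?line ` ({1..2 * m} - {m, m + 1})"
    using index_image_shift[OF assms] by simp
  also have "\<dots> = id_diagram m - {?line m, ?line (m + 1)}"
    unfolding img by (auto simp: doubleton_eq_iff)
  finally show ?thesis
    by (auto simp: e_diagram_def add_cups_def)
qed

section \<open>Concatenation of diagrams with a cup and a cap\<close>

text \<open>
  A picture with two columns inserted in which the new vertices of each row, the middle one included,
  are joined to each other.
\<close>

definition add_links :: "nat \<Rightarrow> vertex set set \<Rightarrow> vertex set set" where
  "add_links m E = map_diagram (shift m) E \<union> range (\<lambda>r. {(r, m), (r, m + 1)})"

text \<open>
  On the middle line the cap of the upper diagram and the cup of the lower one have the same end points,
  so as sets of vertices they form a single link.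
\<close>

lemma stack_add_cups:
  "stack (add_cups m c1) (add_cups m c2) = add_links m (stack c1 c2)"
proof -
  have "upper (shift m v) = shift m (upper v)" "lower (shift m v) = shift m (lower v)" for v
    by (cases v; simp add: upper_def lower_def shift.simps)+
  then have old: "map_diagram upper (map_diagram (shift m) c1) = map_diagram (shift m) (map_diagram upper c1)"
    "map_diagram lower (map_diagram (shift m) c2) = map_diagram (shift m) (map_diagram lower c2)"
    by (simp_all add: map_diagram_def image_image)
  have "(UNIV :: row set) = {North, Middle, South}"
    using row.exhaust by auto
  then have "range (\<lambda>r. {(r, m), (r, m + 1)}) =
      (\<lambda>r. {(r, m), (r, m + 1)}) ` {North, Middle, South}"
    by simp
  then have centre: "map_diagram upper (cup_cap m) \<union> map_diagram lower (cup_cap m) =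
      range (\<lambda>r. {(r, m), (r, m + 1)})"
    by (simp add: cup_cap_def map_diagram_def upper_def lower_def insert_commute)
  have "stack (add_cups m c1) (add_cups m c2) =
      (map_diagram upper (cup_cap m) \<union> map_diagram lower (cup_cap m)) \<union>
      (map_diagram upper (map_diagram (shift m) c1) \<union> map_diagram lower (map_diagram (shift m) c2))"
    by (simp only: stack_def add_cups_def map_diagram_def image_Un Un_ac)
  then show ?thesis
    unfolding centre old by (simp only: add_links_def stack_def map_diagram_def image_Un Un_ac)
qed

lemma connected_in_refl [simp]: "(x, x) \<in> connected_in E"
  by (simp add: connected_in_def)

lemma connected_in_edge: "{x, y} \<in> E \<Longrightarrow> (x, y) \<in> connected_in E"
  by (auto simp: connected_in_def)

lemma connected_in_step: "(x, y) \<in> connected_in E \<Longrightarrow> {y, z} \<in> E \<Longrightarrow> (x, z) \<in> connected_in E"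
  unfolding connected_in_def by (erule rtrancl_into_rtrancl) simp

lemma connected_in_trans [trans]:
  "(x, y) \<in> connected_in E \<Longrightarrow> (y, z) \<in> connected_in E \<Longrightarrow> (x, z) \<in> connected_in E"
  unfolding connected_in_def by (rule rtrancl_trans)

lemma connected_in_induct [consumes 1, case_names refl step]:
  assumes "(x, y) \<in> connected_in E" "P x"
    and "\<And>y z. (x, y) \<in> connected_in E \<Longrightarrow> {y, z} \<in> E \<Longrightarrow> P y \<Longrightarrow> P z"
  shows "P y"
  using assms(1) unfolding connected_in_def
  by (induction rule: rtrancl_induct) (use assms in \<open>auto simp: connected_in_def\<close>)

lemma connected_in_subset: "connected_in E `` {x} \<subseteq> insert x (\<Union> E)"
proof
  fix y assume "y \<in> connected_in E `` {x}"
  then have "(x, y) \<in> connected_in E" by simp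
  then show "y \<in> insert x (\<Union> E)"
    by (induction rule: connected_in_induct) auto
qed

text \<open>
  No edge joins an old vertex to a link, so a path that starts in the old part stays there.
\<close>

lemma connected_in_shift:
  "connected_in (add_links m E) `` {shift m v} = shift m ` (connected_in E `` {v})"
proof
  have edge: "\<exists>w. z = shift m w \<and> {u, w} \<in> E" if "{shift m u, z} \<in> add_links m E" for u z
  proof -
    have "{shift m u, z} \<notin> range (\<lambda>r. {(r, m), (r, m + 1)})"
      by (auto simp: doubleton_eq_iff)
    then have "{shift m u, z} \<in> map_diagram (shift m) E"
      using that by (simp add: add_links_def)
    then obtain l where l: "l \<in> E" "{shift m u, z} = shift m ` l"
      unfolding map_diagram_def by blast
    then obtain w where w: "z = shift m w"
      by blast
    have "shift m ` {u, w} = shift m ` l"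
      using l w by simp
    then have "{u, w} = l"
      by (rule shift_image_eq_iff[THEN iffD1])
    then show ?thesis
      using l w by blast
  qed
  show "connected_in (add_links m E) `` {shift m v} \<subseteq> shift m ` (connected_in E `` {v})"
  proof
    fix z assume "z \<in> connected_in (add_links m E) `` {shift m v}"
    then have "(shift m v, z) \<in> connected_in (add_links m E)" by simp
    then show "z \<in> shift m ` (connected_in E `` {v})"
    proof (induction rule: connected_in_induct)
      case (step y z)
      then obtain u where "y = shift m u" "(v, u) \<in> connected_in E" by blast
      moreover from this edge step obtain w where "z = shift m w" "{u, w} \<in> E" by blast
      ultimately show ?case using connected_in_step by blast
    qed simp
  qed
  show "shift m ` (connected_in E `` {v}) \<subseteq> connected_in (add_links m E) `` {shift m v}"
  proof
    fix z assume "z \<in> shift m ` (connected_in E `` {v})"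
    then obtain w where w: "z = shift m w" "(v, w) \<in> connected_in E" by blast
    from w(2) have "(shift m v, shift m w) \<in> connected_in (add_links m E)"
    proof (induction rule: connected_in_induct)
      case (step y z)
      have "shift m ` {y, z} \<in> add_links m E"
        using step(2) by (auto simp: add_links_def map_diagram_def simp del: image_insert)
      then show ?case using step(3) connected_in_step by simp
    qed simp
    then show "z \<in> connected_in (add_links m E) `` {shift m v}"
      using w(1) by simp
  qed
qed

lemma connected_in_centre:
  assumes "v \<in> {(r, m), (r, m + 1)}"
  shows "connected_in (add_links m E) `` {v} = {(r, m), (r, m + 1)}"
proof
  have edge: "z \<in> {(r, m), (r, m + 1)}" if uz: "{u, z} \<in> add_links m E" "u \<in> {(r, m), (r, m + 1)}" for u z
  proof -
    have "u \<notin> shift m ` l" for l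
      using that(2) by auto
    then have "{u, z} \<notin> map_diagram (shift m) E"
      unfolding map_diagram_def by blast
    then obtain r' where "{u, z} = {(r', m), (r', m + 1)}"
      using uz(1) unfolding add_links_def by blast
    then show ?thesis
      using that(2) by (auto simp: doubleton_eq_iff)
  qed
  show "connected_in (add_links m E) `` {v} \<subseteq> {(r, m), (r, m + 1)}"
  proof
    fix z assume "z \<in> connected_in (add_links m E) `` {v}"
    then have "(v, z) \<in> connected_in (add_links m E)" by simp
    then show "z \<in> {(r, m), (r, m + 1)}"
    proof (induction rule: connected_in_induct)
      case refl
      show ?case by (rule assms)
    next
      case (step y z)
      from step(2,3) show ?case by (rule edge)
    qed
  qed
  have "{(r, m), (r, m + 1)} \<in> add_links m E"
    by (auto simp: add_links_def)
  then have "((r, m), (r, m + 1)) \<in> connected_in (add_links m E)" "((r, m + 1), (r, m)) \<in> connected_in (add_links m E)"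
    by (simp_all only: connected_in_edge insert_commute[of "(r, m + 1)"])
  then show "{(r, m), (r, m + 1)} \<subseteq> connected_in (add_links m E) `` {v}"
    using assms by auto
qed

lemmas connected_add_cups =
  connected_in_shift[of m "stack c1 c2" for m c1 c2, folded stack_add_cups]
  connected_in_centre[of _ _ m "stack c1 c2" for m c1 c2, folded stack_add_cups]

lemma composeI:
  "x \<in> vertices (2 * m) \<Longrightarrow> y \<in> vertices (2 * m) \<Longrightarrow> x \<noteq> y \<Longrightarrow>
    (x, y) \<in> connected_in (stack d1 d2) \<Longrightarrow> {x, y} \<in> compose m d1 d2"
  unfolding compose_def by blast

lemma composeE:
  assumes "l \<in> compose m d1 d2"
  obtains x y where "l = {x, y}" "x \<noteq> y" "x \<in> vertices (2 * m)" "y \<in> vertices (2 * m)"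
    "(x, y) \<in> connected_in (stack d1 d2)"
  using assms unfolding compose_def by blast

text \<open>
  The links in the outer rows give the cup and the cap of the product, and all other lines come from
  paths of the old picture.
\<close>

lemma compose_add_cups:
  assumes "m \<ge> 1"
  shows "compose m (add_cups m c1) (add_cups m c2) = add_cups m (compose (m - 1) c1 c2)"
proof
  let ?E = "stack (add_cups m c1) (add_cups m c2)" and ?E' = "stack c1 c2"
  let ?V = "vertices (2 * m)" and ?V' = "vertices (2 * (m - 1))"
  show "compose m (add_cups m c1) (add_cups m c2) \<subseteq> add_cups m (compose (m - 1) c1 c2)"
  proof
    fix l assume "l \<in> compose m (add_cups m c1) (add_cups m c2)"
    then obtain x y where l: "l = {x, y}" "x \<noteq> y" "x \<in> ?V" "y \<in> ?V" "y \<in> connected_in ?E `` {x}"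
      by (auto elim!: composeE)
    consider r where "r \<in> {North, South}" "x \<in> {(r, m), (r, m + 1)}" | v where "x = shift m v" "v \<in> ?V'"
      using l(3) vertices_shift[OF assms] by blast
    then show "l \<in> add_cups m (compose (m - 1) c1 c2)"
    proof cases
      case 1
      then have "l = {(r, m), (r, m + 1)}"
        using l connected_add_cups(2)[OF 1(2), of c1 c2] by auto
      then show ?thesis
        using 1 by (auto simp: add_cups_def cup_cap_def)
    next
      case 2
      then obtain w where w: "y = shift m w" "(v, w) \<in> connected_in ?E'"
        using l connected_add_cups(1)[of m c1 c2 v] by auto
      have "w \<in> ?V'" "v \<noteq> w"
        using w l 2 assms by auto
      then have "{v, w} \<in> compose (m - 1) c1 c2"
        using w 2 by (intro composeI)
      then show ?thesis
        using shift_line_in_add_cups[of "{v, w}"] l w 2 by simp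
    qed
  qed
  show "add_cups m (compose (m - 1) c1 c2) \<subseteq> compose m (add_cups m c1) (add_cups m c2)"
  proof
    fix l assume "l \<in> add_cups m (compose (m - 1) c1 c2)"
    then consider r where "l = {(r, m), (r, m + 1)}" "r \<in> {North, South}"
      | k where "l = shift m ` k" "k \<in> compose (m - 1) c1 c2"
      by (auto simp: add_cups_def cup_cap_def map_diagram_def)
    then show "l \<in> compose m (add_cups m c1) (add_cups m c2)"
    proof cases
      case 1
      then have "((r, m), (r, m + 1)) \<in> connected_in ?E"
        using connected_add_cups(2)[of "(r, m)" r m c1 c2] by auto
      moreover have "(r, m) \<in> ?V" "(r, m + 1) \<in> ?V"
        using 1 assms by (auto simp: vertices_def)
      ultimately show ?thesis
        unfolding 1(1) by (intro composeI) auto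
    next
      case 2
      then obtain v w where k: "k = {v, w}" "v \<noteq> w" "v \<in> ?V'" "w \<in> ?V'" "(v, w) \<in> connected_in ?E'"
        by (auto elim!: composeE)
      then have "(shift m v, shift m w) \<in> connected_in ?E"
        using connected_add_cups(1)[of m c1 c2 v] by blast
      then have "{shift m v, shift m w} \<in> compose m (add_cups m c1) (add_cups m c2)"
        using k assms by (intro composeI) auto
      then show ?thesis
        using 2 k by simp
    qed
  qed
qed

lemma loops_eq:
  "loops m d1 d2 = {L \<in> (\<lambda>v. connected_in (stack d1 d2) `` {v}) ` ({Middle} \<times> {1..2 * m}).
     L \<subseteq> {Middle} \<times> UNIV}"
  by (auto simp: loops_def)

text \<open>
  The one new loop is the link in the middle row.
\<close>

lemma loops_add_cups:
  assumes "m \<ge> 1"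
  shows "loops m (add_cups m c1) (add_cups m c2) =
    insert {(Middle, m), (Middle, m + 1)} ((`) (shift m) ` loops (m - 1) c1 c2)"
proof -
  let ?comp = "\<lambda>v. connected_in (stack (add_cups m c1) (add_cups m c2)) `` {v}"
  let ?small = "{(Middle, m), (Middle, m + 1)}"
  have filter: "{L \<in> insert ?small (f ` X). L \<subseteq> {Middle} \<times> UNIV} =
      insert ?small (f ` {L \<in> X. L \<subseteq> {Middle} \<times> UNIV})"
    if "\<And>L. f L \<subseteq> {Middle} \<times> UNIV \<longleftrightarrow> L \<subseteq> {Middle} \<times> UNIV" for f :: "vertex set \<Rightarrow> vertex set" and X
    using that by auto
  have "{Middle} \<times> {1..2 * m} = ?small \<union> shift m ` ({Middle} \<times> {1..2 * (m - 1)})"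
    unfolding shift_image_times[OF assms] using assms by auto
  moreover have "?comp ` ?small = {?small}"
    using connected_add_cups(2)[of _ Middle m c1 c2] by simp
  moreover have "?comp ` shift m ` X = (`) (shift m) ` (\<lambda>v. connected_in (stack c1 c2) `` {v}) ` X" for X
    using connected_add_cups(1)[of m c1 c2] by (simp add: image_image)
  ultimately have "?comp ` ({Middle} \<times> {1..2 * m}) =
      insert ?small ((`) (shift m) ` (\<lambda>v. connected_in (stack c1 c2) `` {v}) ` ({Middle} \<times> {1..2 * (m - 1)}))"
    by (simp add: image_Un)
  moreover have "shift m ` L \<subseteq> {Middle} \<times> UNIV \<longleftrightarrow> L \<subseteq> {Middle} \<times> UNIV" for L
  proof -
    have "shift m v \<in> {Middle} \<times> UNIV \<longleftrightarrow> v \<in> {Middle} \<times> UNIV" for v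
      by (cases v) (simp add: shift.simps)
    then show ?thesis by blast
  qed
  ultimately show ?thesis
    unfolding loops_eq by (simp only: filter)
qed

section \<open>Colours and numbers of closed loops\<close>

lemma finite_vertices: "finite (vertices n)"
  by (simp add: vertices_def)

lemma finite_pairing:
  assumes "pairing n d"
  shows "finite d"
proof -
  have "d \<subseteq> Pow (vertices n)"
    using pairing_subset[OF assms] by blast
  then show ?thesis
    by (rule finite_subset) (simp add: finite_vertices)
qed

text \<open>
  Count the vertices in \<open>R\<close> line by line: a line contributes 0, 1 or 2, and it contributes 1 iff \<open>R\<close>
  separates its end points.
\<close>

lemma even_card_separated_lines:
  assumes "pairing n d"
  shows "even (card {l \<in> d. l \<inter> R \<noteq> {} \<and> \<not> l \<subseteq> R}) \<longleftrightarrow> even (card (vertices n \<inter> R))"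
proof -
  have fin: "finite d" "\<And>l. l \<in> d \<Longrightarrow> finite l"
    using finite_pairing[OF assms] pairing_subset[OF assms] finite_vertices finite_subset by blast+
  have "vertices n \<inter> R = (\<Union>l\<in>d. l \<inter> R)"
    using assms by (auto simp: pairing_def)
  also have "card \<dots> = (\<Sum>l\<in>d. card (l \<inter> R))"
    using fin pairing_disjoint[OF assms] by (intro card_UN_disjoint) auto
  finally have "even (card (vertices n \<inter> R)) \<longleftrightarrow> even (card {l \<in> d. odd (card (l \<inter> R))})"
    using fin(1) by (simp add: even_sum_iff)
  moreover have "odd (card (l \<inter> R)) \<longleftrightarrow> l \<inter> R \<noteq> {} \<and> \<not> l \<subseteq> R" if l: "l \<in> d" for l
  proof -
    obtain a b where ab: "l = {a, b}" "a \<noteq> b"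
      using pairing_line[OF assms l] by blast
    then show ?thesis
      by (cases "a \<in> R"; cases "b \<in> R") (simp_all add: Int_insert_left)
  qed
  ultimately show ?thesis
    by (simp cong: conj_cong)
qed

text \<open>
  To the right of a path from the northern gap \<open>m\<close> to the southern gap \<open>j\<close> there are
  \<open>m + (2 * m - j)\<close> vertices.
\<close>

lemma white_gap_iff_even:
  assumes "pairing (2 * m) d" "j \<le> 2 * m"
  shows "white_gap m d j \<longleftrightarrow> even (m + j)"
proof -
  have "vertices (2 * m) \<inter> right_of m j = {North} \<times> {m<..2 * m} \<union> {South} \<times> {j<..2 * m}"
    by (auto simp: vertices_def right_of_def)
  moreover have "card ({North} \<times> {m<..2 * m} \<union> {South} \<times> {j<..2 * m}) = m + (2 * m - j)"
    by (subst card_Un_disjoint) auto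
  ultimately have "white_gap m d j \<longleftrightarrow> even (m + (2 * m - j))"
    unfolding white_gap_def even_card_separated_lines[OF assms(1)] by simp
  then show ?thesis
    using assms(2) by simp
qed

lemma finite_loops: "finite (loops m d1 d2)"
  unfolding loops_eq by simp

lemma finite_Union_stack:
  assumes "pairing n d1" "pairing n d2"
  shows "finite (\<Union> (stack d1 d2))"
proof -
  have "\<Union> (stack d1 d2) = upper ` \<Union> d1 \<union> lower ` \<Union> d2"
    by (auto simp: stack_def map_diagram_def)
  also have "\<dots> = upper ` vertices n \<union> lower ` vertices n"
    using assms by (simp add: pairing_def)
  finally have "\<Union> (stack d1 d2) = upper ` vertices n \<union> lower ` vertices n" .
  then show ?thesis
    by (simp add: finite_vertices)
qed

text \<open>
  These facts make \<open>Min (snd ` L)\<close> meaningful as the leftmost vertex of the loop.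
\<close>

lemma loop_finite_Min_le:
  assumes "pairing (2 * m) d1" "pairing (2 * m) d2" "L \<in> loops m d1 d2"
  shows "finite L" "L \<noteq> {}" "Min (snd ` L) \<le> 2 * m"
proof -
  obtain i where i: "i \<in> {1..2 * m}" "L = connected_in (stack d1 d2) `` {(Middle, i)}"
    using assms(3) by (auto simp: loops_def)
  then have "L \<subseteq> insert (Middle, i) (\<Union> (stack d1 d2))"
    using connected_in_subset by simp
  then show fin: "finite L"
    using finite_subset finite_Union_stack[OF assms(1,2)] by blast
  have "(Middle, i) \<in> L"
    using i by simp
  then show "L \<noteq> {}" by blast
  have "Min (snd ` L) \<le> i"
    using fin \<open>(Middle, i) \<in> L\<close> by (intro Min_le) force+
  then show "Min (snd ` L) \<le> 2 * m"
    using i by simp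
qed

lemma interior_white_iff_even:
  assumes "pairing (2 * m) d1" "pairing (2 * m) d2" "L \<in> loops m d1 d2"
  shows "interior_white m d1 L \<longleftrightarrow> even (m + Min (snd ` L))"
  unfolding interior_white_def
  using white_gap_iff_even[OF assms(1) loop_finite_Min_le(3)[OF assms]] .

lemma crosses_centre_shift:
  assumes "m \<ge> 1"
  shows "crosses_centre m (shift m ` L) \<longleftrightarrow> crosses_centre (m - 1) L"
proof -
  have "snd (shift m v) \<le> m \<longleftrightarrow> snd v \<le> m - 1" "m < snd (shift m v) \<longleftrightarrow> m - 1 < snd v" for v
    using assms by (auto simp: snd_shift)
  then show ?thesis
    by (simp add: crosses_centre_def)
qed

text \<open>
  This is where the colours are exchanged. A loop across the centre line has its leftmost vertex to the
  left of the inserted columns, so that vertex is not moved, but \<open>m\<close> changes by one and with it the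
  parity that determines the colour.
\<close>

lemma interior_white_shift:
  assumes "m \<ge> 1" "pairing (2 * (m - 1)) c1" "pairing (2 * (m - 1)) c2"
    and L: "L \<in> loops (m - 1) c1 c2" "crosses_centre (m - 1) L"
  shows "interior_white m (add_cups m c1) (shift m ` L) \<longleftrightarrow> \<not> interior_white (m - 1) c1 L"
proof -
  note fin = loop_finite_Min_le[OF assms(2,3) L(1)]
  let ?f = "\<lambda>i. if i < m then i else i + 2"
  obtain v where "v \<in> L" "snd v \<le> m - 1"
    using L(2) by (auto simp: crosses_centre_def)
  then have "Min (snd ` L) \<le> m - 1"
    using fin(1) by (meson Min_le finite_imageI image_eqI order_trans)
  \<comment> \<open>the index map fixes the numbers below \<open>m\<close>, so the leftmost vertex stays where it is\<close>
  then have small: "Min (snd ` L) < m"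
    using assms(1) by simp
  have "snd ` shift m ` L = ?f ` snd ` L"
    unfolding image_image by (simp only: snd_shift)
  moreover have "?f (Min (snd ` L)) = Min (?f ` snd ` L)"
    using fin(1,2) by (intro mono_Min_commute) (auto simp: mono_def)
  ultimately have "Min (snd ` shift m ` L) = Min (snd ` L)"
    using small by simp
  moreover have "shift m ` L \<in> loops m (add_cups m c1) (add_cups m c2)"
    using L(1) by (simp add: loops_add_cups[OF assms(1)])
  then have "interior_white m (add_cups m c1) (shift m ` L) \<longleftrightarrow> even (m + Min (snd ` shift m ` L))"
    by (intro interior_white_iff_even) (use assms pairing_add_cups in auto)
  moreover have "interior_white (m - 1) c1 L \<longleftrightarrow> even (m - 1 + Min (snd ` L))"
    by (rule interior_white_iff_even[OF assms(2,3) L(1)])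
  ultimately show ?thesis
    using assms(1) by simp
qed

lemma centre_loop_white:
  assumes "m \<ge> 1" "pairing (2 * (m - 1)) c1"
  shows "interior_white m (add_cups m c1) {(Middle, m), (Middle, m + 1)}"
proof -
  have "pairing (2 * m) (add_cups m c1)"
    using assms pairing_add_cups by simp
  then have "white_gap m (add_cups m c1) m"
    by (subst white_gap_iff_even) auto
  then show ?thesis
    by (simp add: interior_white_def)
qed

lemma centre_loop_crosses: "crosses_centre m {(Middle, m), (Middle, m + 1)}"
  by (simp add: crosses_centre_def)

lemma centre_loop_notin_shift: "{(Middle, m), (Middle, m + 1)} \<notin> (`) (shift m) ` X"
proof
  assume "{(Middle, m), (Middle, m + 1)} \<in> (`) (shift m) ` X"
  then obtain L where L: "{(Middle, m), (Middle, m + 1)} = shift m ` L"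
    by (rule imageE)
  have "(Middle, m) \<in> shift m ` L"
    unfolding L[symmetric] by simp
  then show False by simp
qed

lemma inj_on_shift_image: "inj_on ((`) (shift m)) X"
  by (simp add: inj_on_def)

lemma loops_pairs_add_cups:
  assumes "m \<ge> 1"
  shows "loops_pairs m (add_cups m c1) (add_cups m c2) = loops_pairs (m - 1) c1 c2"
proof -
  let ?P = "\<lambda>n L. {L, mirror n ` L}"
  let ?X = "{L \<in> loops (m - 1) c1 c2. \<not> crosses_centre (m - 1) L}"
  have "{L \<in> loops m (add_cups m c1) (add_cups m c2). \<not> crosses_centre m L} = (`) (shift m) ` ?X"
    using centre_loop_crosses[of m]
    by (auto simp: loops_add_cups[OF assms] crosses_centre_shift[OF assms])
  moreover have "?P m (shift m ` L) = (`) (shift m) ` ?P (m - 1) L" for L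
    by (simp add: image_image mirror_shift[OF assms])
  ultimately have "?P m ` {L \<in> loops m (add_cups m c1) (add_cups m c2). \<not> crosses_centre m L} =
      (`) ((`) (shift m)) ` ?P (m - 1) ` ?X"
    by (simp add: image_image)
  moreover have "{?P n L | L. L \<in> X \<and> Q L} = ?P n ` {L \<in> X. Q L}" for n X Q
    by blast
  moreover have "inj_on ((`) ((`) (shift m))) Y" for Y
    by (rule inj_on_image) (rule inj_on_shift_image)
  ultimately show ?thesis
    by (simp add: loops_pairs_def card_image)
qed

lemma loops_white_add_cups:
  assumes "m \<ge> 1" "pairing (2 * (m - 1)) c1" "pairing (2 * (m - 1)) c2"
  shows "loops_white m (add_cups m c1) (add_cups m c2) = Suc (loops_black (m - 1) c1 c2)"
proof -
  let ?X = "{L \<in> loops (m - 1) c1 c2. crosses_centre (m - 1) L \<and> \<not> interior_white (m - 1) c1 L}"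
  have "{L \<in> loops m (add_cups m c1) (add_cups m c2). crosses_centre m L \<and>
        interior_white m (add_cups m c1) L} =
      insert {(Middle, m), (Middle, m + 1)} ((`) (shift m) ` ?X)"
    using centre_loop_crosses[of m] centre_loop_white[OF assms(1,2)]
    by (auto simp: loops_add_cups[OF assms(1)] crosses_centre_shift[OF assms(1)]
        interior_white_shift[OF assms] simp del: image_insert)
  moreover have "finite ?X"
    using finite_loops by simp
  ultimately show ?thesis
    using centre_loop_notin_shift[of m ?X]
    by (simp add: loops_white_def loops_black_def card_image inj_on_shift_image)
qed

lemma loops_black_add_cups:
  assumes "m \<ge> 1" "pairing (2 * (m - 1)) c1" "pairing (2 * (m - 1)) c2"
  shows "loops_black m (add_cups m c1) (add_cups m c2) = loops_white (m - 1) c1 c2"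
proof -
  let ?X = "{L \<in> loops (m - 1) c1 c2. crosses_centre (m - 1) L \<and> interior_white (m - 1) c1 L}"
  have "{L \<in> loops m (add_cups m c1) (add_cups m c2). crosses_centre m L \<and>
        \<not> interior_white m (add_cups m c1) L} = (`) (shift m) ` ?X"
    using centre_loop_crosses[of m] centre_loop_white[OF assms(1,2)]
    by (auto simp: loops_add_cups[OF assms(1)] crosses_centre_shift[OF assms(1)]
        interior_white_shift[OF assms] simp del: image_insert)
  then show ?thesis
    by (simp add: loops_white_def loops_black_def card_image inj_on_shift_image)
qed

section \<open>The identity diagram is neutral\<close>

lemma connected_in_sym: "(x, y) \<in> connected_in E \<Longrightarrow> (y, x) \<in> connected_in E"
  unfolding connected_in_def
  by (rule symD[OF sym_rtrancl]) (auto simp: sym_def insert_commute)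

text \<open>
  A map \<open>q\<close> that sends every edge to a point or to a line of a pairing \<open>c\<close> sends every path to a point or
  to a line of \<open>c\<close>, because the lines of \<open>c\<close> do not meet.
\<close>

lemma connected_in_retract:
  assumes "pairing n c" "(x, y) \<in> connected_in E"
    and edge: "\<And>x y. {x, y} \<in> E \<Longrightarrow> q x = q y \<or> {q x, q y} \<in> c"
  shows "q x = q y \<or> {q x, q y} \<in> c"
  using assms(2)
proof (induction rule: connected_in_induct)
  case (step y z)
  have "q x = q z" if "{q x, q y} \<in> c" "{q y, q z} \<in> c"
  proof -
    have "{q x, q y} = {q y, q z}"
      using pairing_disjoint[OF assms(1) that] by blast
    then show ?thesis by (auto simp: doubleton_eq_iff)
  qed
  then show ?case
    using step(3) edge[OF step(2)] by auto
qed simp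

text \<open>
  The scheme for multiplication by the identity: \<open>q\<close> contracts the vertical strands of the identity
  diagram, and \<open>f\<close> runs along them from the outer edge to the copy of \<open>c\<close> in the stacked picture.
\<close>

lemma compose_retract:
  assumes "pairing (2 * m) c"
    and edge: "\<And>x y. {x, y} \<in> stack d1 d2 \<Longrightarrow> q x = q y \<or> {q x, q y} \<in> c"
    and q: "\<And>v. v \<in> vertices (2 * m) \<Longrightarrow> q v = v"
    and f: "\<And>v. v \<in> vertices (2 * m) \<Longrightarrow> (v, f v) \<in> connected_in (stack d1 d2)"
    and line: "\<And>l. l \<in> c \<Longrightarrow> f ` l \<in> stack d1 d2"
  shows "compose m d1 d2 = c"
proof
  show "compose m d1 d2 \<subseteq> c"
  proof
    fix l assume "l \<in> compose m d1 d2"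
    then obtain x y where l: "l = {x, y}" "x \<noteq> y" "x \<in> vertices (2 * m)" "y \<in> vertices (2 * m)"
      "(x, y) \<in> connected_in (stack d1 d2)" by (rule composeE)
    have "q x = q y \<or> {q x, q y} \<in> c"
      using assms(1) l(5) edge by (rule connected_in_retract)
    then show "l \<in> c"
      using l q by simp
  qed
  show "c \<subseteq> compose m d1 d2"
  proof
    fix l assume l: "l \<in> c"
    then obtain a b where ab: "l = {a, b}" "a \<noteq> b" "a \<in> vertices (2 * m)" "b \<in> vertices (2 * m)"
      using pairing_line[OF assms(1)] by blast
    have "(a, f a) \<in> connected_in (stack d1 d2)"
      by (rule f) fact
    also have "(f a, f b) \<in> connected_in (stack d1 d2)"
      using line[OF l] ab(1) by (intro connected_in_edge) simp
    also have "(f b, b) \<in> connected_in (stack d1 d2)"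
      by (rule connected_in_sym[OF f]) fact
    finally show "l \<in> compose m d1 d2"
      unfolding ab(1) using ab by (intro composeI)
  qed
qed

lemma stack_id_left:
  "stack (id_diagram m) c = (\<lambda>i. {(North, i), (Middle, i)}) ` {1..2 * m} \<union> map_diagram lower c"
proof -
  have "id_diagram m = (\<lambda>i. {(North, i), (South, i)}) ` {1..2 * m}"
    by (auto simp: id_diagram_def)
  then show ?thesis
    by (simp add: stack_def map_diagram_def image_image upper_def)
qed

lemma stack_id_right:
  "stack c (id_diagram m) = map_diagram upper c \<union> (\<lambda>i. {(Middle, i), (South, i)}) ` {1..2 * m}"
proof -
  have "id_diagram m = (\<lambda>i. {(North, i), (South, i)}) ` {1..2 * m}"
    by (auto simp: id_diagram_def)
  then show ?thesis
    by (simp add: stack_def map_diagram_def image_image lower_def)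
qed

lemma image_eq_self: "(\<And>x. x \<in> A \<Longrightarrow> f x = x) \<Longrightarrow> f ` A = A"
  by (metis image_cong image_ident)

lemma compose_id_left:
  assumes "pairing (2 * m) c"
  shows "compose m (id_diagram m) c = c"
proof (rule compose_retract[where f = lower])
  let ?q = "\<lambda>v. if fst v = Middle then (North, snd v) else v"
  have q_lower: "?q (lower v) = v" if "v \<in> vertices n" for v n
    using that by (auto simp: vertices_def lower_def)
  show "?q x = ?q y \<or> {?q x, ?q y} \<in> c" if e: "{x, y} \<in> stack (id_diagram m) c" for x y
  proof -
    consider i where "{x, y} = {(North, i), (Middle, i)}" | l where "l \<in> c" "{x, y} = lower ` l"
      using e unfolding stack_id_left map_diagram_def by blast
    then show ?thesis
    proof cases
      case 1
      then show ?thesis by (auto simp: doubleton_eq_iff)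
    next
      case 2
      have "{?q x, ?q y} = ?q ` lower ` l"
        unfolding 2(2)[symmetric] by simp
      also have "\<dots> = l"
        unfolding image_image
        by (rule image_eq_self) (use pairing_subset[OF assms 2(1)] q_lower in blast)
      finally show ?thesis using 2(1) by simp
    qed
  qed
  show "?q v = v" if "v \<in> vertices (2 * m)" for v
    using that by (auto simp: vertices_def)
  show "(v, lower v) \<in> connected_in (stack (id_diagram m) c)" if v: "v \<in> vertices (2 * m)" for v
  proof (cases "fst v = North")
    case True
    then have "{v, lower v} \<in> stack (id_diagram m) c"
      using v by (auto simp: vertices_def lower_def stack_id_left)
    then show ?thesis by (rule connected_in_edge)
  next
    case False
    then have "lower v = v" by (cases v) (simp add: lower_def)
    then show ?thesis by simp
  qed
qed (auto simp: stack_id_left map_diagram_def assms)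

lemma compose_id_right:
  assumes "pairing (2 * m) c"
  shows "compose m c (id_diagram m) = c"
proof (rule compose_retract[where f = upper])
  let ?q = "\<lambda>v. if fst v = Middle then (South, snd v) else v"
  have q_upper: "?q (upper v) = v" if "v \<in> vertices n" for v n
    using that by (auto simp: vertices_def upper_def)
  show "?q x = ?q y \<or> {?q x, ?q y} \<in> c" if e: "{x, y} \<in> stack c (id_diagram m)" for x y
  proof -
    consider i where "{x, y} = {(Middle, i), (South, i)}" | l where "l \<in> c" "{x, y} = upper ` l"
      using e unfolding stack_id_right map_diagram_def by blast
    then show ?thesis
    proof cases
      case 1
      then show ?thesis by (auto simp: doubleton_eq_iff)
    next
      case 2
      have "{?q x, ?q y} = ?q ` upper ` l"
        unfolding 2(2)[symmetric] by simp
      also have "\<dots> = l"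
        unfolding image_image
        by (rule image_eq_self) (use pairing_subset[OF assms 2(1)] q_upper in blast)
      finally show ?thesis using 2(1) by simp
    qed
  qed
  show "?q v = v" if "v \<in> vertices (2 * m)" for v
    using that by (auto simp: vertices_def)
  show "(v, upper v) \<in> connected_in (stack c (id_diagram m))" if v: "v \<in> vertices (2 * m)" for v
  proof (cases "fst v = South")
    case True
    then have "{upper v, v} \<in> stack c (id_diagram m)"
      using v by (auto simp: vertices_def upper_def stack_id_right)
    then show ?thesis by (rule connected_in_sym[OF connected_in_edge])
  next
    case False
    then have "upper v = v" by (cases v) (simp add: upper_def)
    then show ?thesis by simp
  qed
qed (auto simp: stack_id_right map_diagram_def assms)

text \<open>
  Whenever every middle vertex has a neighbour on an outer edge, no component stays on the middle line.
\<close>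

lemma loops_eq_empty:
  assumes "\<And>i. i \<in> {1..2 * m} \<Longrightarrow> \<exists>r. r \<noteq> Middle \<and> {(Middle, i), (r, i)} \<in> stack d1 d2"
  shows "loops m d1 d2 = {}"
proof (rule equals0I)
  fix L assume "L \<in> loops m d1 d2"
  then obtain i where i: "i \<in> {1..2 * m}" "L = connected_in (stack d1 d2) `` {(Middle, i)}"
    "L \<subseteq> {Middle} \<times> UNIV" by (auto simp: loops_def)
  obtain r where r: "r \<noteq> Middle" "{(Middle, i), (r, i)} \<in> stack d1 d2"
    using assms i(1) by blast
  have "(r, i) \<in> L"
    using connected_in_edge[OF r(2)] i(2) by simp
  then show False
    using i(3) r(1) by auto
qed

lemma loops_id: "loops m (id_diagram m) c = {}" "loops m c (id_diagram m) = {}"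
proof -
  show "loops m (id_diagram m) c = {}"
    by (rule loops_eq_empty, rule exI[of _ North]) (auto simp: stack_id_left insert_commute)
  show "loops m c (id_diagram m) = {}"
    by (rule loops_eq_empty, rule exI[of _ South]) (auto simp: stack_id_right)
qed

lemma pairing_JB: "d \<in> JB m \<Longrightarrow> pairing (2 * m) d"
  by (simp add: JB_def TL_def)

lemma finite_JB: "finite (JB m)"
proof (rule finite_subset)
  show "JB m \<subseteq> Pow (Pow (vertices (2 * m)))"
    using pairing_subset[OF pairing_JB] by blast
qed (simp add: finite_vertices)

section \<open>Multiplication of coefficient functions\<close>

lemma b_alg_simps:
  "carrier (b_alg K m \<alpha> \<beta> \<gamma>) = JB m \<rightarrow>\<^sub>E carrier K"
  "\<one>\<^bsub>b_alg K m \<alpha> \<beta> \<gamma>\<^esub> = basis K m (id_diagram m)"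
  "f \<oplus>\<^bsub>b_alg K m \<alpha> \<beta> \<gamma>\<^esub> g = (\<lambda>c\<in>JB m. f c \<oplus>\<^bsub>K\<^esub> g c)"
  "a \<odot>\<^bsub>b_alg K m \<alpha> \<beta> \<gamma>\<^esub> f = (\<lambda>c\<in>JB m. a \<otimes>\<^bsub>K\<^esub> f c)"
  by (simp_all add: b_alg_def)

definition factorizations :: "nat \<Rightarrow> diagram \<Rightarrow> (diagram \<times> diagram) set" where
  "factorizations m c = {(d1, d2). d1 \<in> JB m \<and> d2 \<in> JB m \<and> compose m d1 d2 = c}"

lemma finite_factorizations: "finite (factorizations m c)"
  by (rule finite_subset[of _ "JB m \<times> JB m"]) (auto simp: factorizations_def finite_JB)

context cring
begin

lemma finsum_eq_single_term:
  assumes "finite B" "a \<in> B" "\<And>i. i \<in> B \<Longrightarrow> i \<noteq> a \<Longrightarrow> h i = \<zero>" "h \<in> B \<rightarrow> carrier R"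
  shows "finsum R h B = h a"
proof -
  have "finsum R h B = finsum R h {a}"
    by (rule add.finprod_mono_neutral_cong_right) (use assms in auto)
  also have "\<dots> = h a"
    using assms by (simp add: Pi_iff)
  finally show ?thesis .
qed

lemma coeff_closed: "f \<in> JB m \<rightarrow>\<^sub>E carrier R \<Longrightarrow> d \<in> JB m \<Longrightarrow> f d \<in> carrier R"
  by (rule PiE_mem)

lemma b_mult_apply:
  "c \<in> JB m \<Longrightarrow> (f \<otimes>\<^bsub>b_alg R m \<alpha> \<beta> \<gamma>\<^esub> g) c =
    (\<Oplus>p\<in>factorizations m c. f (fst p) \<otimes> g (snd p) \<otimes> loop_factor R m \<alpha> \<beta> \<gamma> (fst p) (snd p))"
  by (simp add: b_alg_def factorizations_def)

lemma loop_factor_closed: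
  "\<alpha> \<in> carrier R \<Longrightarrow> \<beta> \<in> carrier R \<Longrightarrow> \<gamma> \<in> carrier R \<Longrightarrow> loop_factor R m \<alpha> \<beta> \<gamma> d1 d2 \<in> carrier R"
  by (simp add: loop_factor_def)

lemma b_term_closed:
  assumes "\<alpha> \<in> carrier R" "\<beta> \<in> carrier R" "\<gamma> \<in> carrier R"
    and "f \<in> JB m \<rightarrow>\<^sub>E carrier R" "g \<in> JB m \<rightarrow>\<^sub>E carrier R"
  shows "(\<lambda>p. f (fst p) \<otimes> g (snd p) \<otimes> loop_factor R m \<alpha> \<beta> \<gamma> (fst p) (snd p))
    \<in> factorizations m c \<rightarrow> carrier R"
  using assms loop_factor_closed by (auto simp: factorizations_def coeff_closed)

lemma b_mult_closed:
  assumes "\<alpha> \<in> carrier R" "\<beta> \<in> carrier R" "\<gamma> \<in> carrier R"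
    and "f \<in> JB m \<rightarrow>\<^sub>E carrier R" "g \<in> JB m \<rightarrow>\<^sub>E carrier R"
  shows "f \<otimes>\<^bsub>b_alg R m \<alpha> \<beta> \<gamma>\<^esub> g \<in> JB m \<rightarrow>\<^sub>E carrier R"
proof (rule PiE_I)
  fix c assume "c \<in> JB m"
  then show "(f \<otimes>\<^bsub>b_alg R m \<alpha> \<beta> \<gamma>\<^esub> g) c \<in> carrier R"
    unfolding b_mult_apply[OF \<open>c \<in> JB m\<close>] by (intro finsum_closed b_term_closed assms)
qed (simp add: b_alg_def)

lemma b_term_zero:
  assumes "\<alpha> \<in> carrier R" "\<beta> \<in> carrier R" "\<gamma> \<in> carrier R"
    and "f \<in> JB m \<rightarrow>\<^sub>E carrier R" "g \<in> JB m \<rightarrow>\<^sub>E carrier R"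
    and "d1 \<in> JB m" "d2 \<in> JB m" "f d1 = \<zero> \<or> g d2 = \<zero>"
  shows "f d1 \<otimes> g d2 \<otimes> loop_factor R m \<alpha> \<beta> \<gamma> d1 d2 = \<zero>"
  using assms(8) coeff_closed[OF assms(4,6)] coeff_closed[OF assms(5,7)]
    loop_factor_closed[OF assms(1-3)] by auto

lemma basis_closed: "basis R m d \<in> JB m \<rightarrow>\<^sub>E carrier R"
  by (auto simp: basis_def)

lemma loop_factor_id:
  "loop_factor R m \<alpha> \<beta> \<gamma> (id_diagram m) c = \<one>" "loop_factor R m \<alpha> \<beta> \<gamma> c (id_diagram m) = \<one>"
  by (simp_all add: loop_factor_def loops_pairs_def loops_white_def loops_black_def loops_id)

lemma b_one_mult:
  assumes "\<alpha> \<in> carrier R" "\<beta> \<in> carrier R" "\<gamma> \<in> carrier R" "f \<in> JB m \<rightarrow>\<^sub>E carrier R"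
  shows "basis R m (id_diagram m) \<otimes>\<^bsub>b_alg R m \<alpha> \<beta> \<gamma>\<^esub> f = f"
proof (rule PiE_ext[OF b_mult_closed assms(4)])
  fix c assume c: "c \<in> JB m"
  have *: "(id_diagram m, c) \<in> factorizations m c"
    using c id_diagram_in_JB compose_id_left[OF pairing_JB] by (simp add: factorizations_def)
  show "(basis R m (id_diagram m) \<otimes>\<^bsub>b_alg R m \<alpha> \<beta> \<gamma>\<^esub> f) c = f c"
    unfolding b_mult_apply[OF c]
  proof (subst finsum_eq_single_term[OF finite_factorizations *])
    fix p assume p: "p \<in> factorizations m c" "p \<noteq> (id_diagram m, c)"
    then have "fst p \<noteq> id_diagram m"
      using compose_id_left[OF pairing_JB] by (auto simp: factorizations_def)
    then show "basis R m (id_diagram m) (fst p) \<otimes> f (snd p) \<otimes>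
        loop_factor R m \<alpha> \<beta> \<gamma> (fst p) (snd p) = \<zero>"
      using p by (intro b_term_zero assms basis_closed) (auto simp: basis_def factorizations_def)
  qed (intro b_term_closed assms basis_closed,
      use c assms coeff_closed id_diagram_in_JB in \<open>simp add: loop_factor_id basis_def\<close>)
qed (use assms basis_closed in auto)

lemma b_mult_one:
  assumes "\<alpha> \<in> carrier R" "\<beta> \<in> carrier R" "\<gamma> \<in> carrier R" "f \<in> JB m \<rightarrow>\<^sub>E carrier R"
  shows "f \<otimes>\<^bsub>b_alg R m \<alpha> \<beta> \<gamma>\<^esub> basis R m (id_diagram m) = f"
proof (rule PiE_ext[OF b_mult_closed assms(4)])
  fix c assume c: "c \<in> JB m"
  have *: "(c, id_diagram m) \<in> factorizations m c"
    using c id_diagram_in_JB compose_id_right[OF pairing_JB] by (simp add: factorizations_def)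
  show "(f \<otimes>\<^bsub>b_alg R m \<alpha> \<beta> \<gamma>\<^esub> basis R m (id_diagram m)) c = f c"
    unfolding b_mult_apply[OF c]
  proof (subst finsum_eq_single_term[OF finite_factorizations *])
    fix p assume p: "p \<in> factorizations m c" "p \<noteq> (c, id_diagram m)"
    then have "snd p \<noteq> id_diagram m"
      using compose_id_right[OF pairing_JB] by (auto simp: factorizations_def)
    then show "f (fst p) \<otimes> basis R m (id_diagram m) (snd p) \<otimes>
        loop_factor R m \<alpha> \<beta> \<gamma> (fst p) (snd p) = \<zero>"
      using p by (intro b_term_zero assms basis_closed) (auto simp: basis_def factorizations_def)
  qed (intro b_term_closed assms basis_closed,
      use c assms coeff_closed id_diagram_in_JB in \<open>simp add: loop_factor_id basis_def\<close>)
qed (use assms basis_closed in auto)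

text \<open>
  The form in which supports of products are controlled: a coefficient vanishes if each factorisation of
  its diagram has a factor outside the support.
\<close>

lemma b_mult_eq_zero:
  assumes "\<alpha> \<in> carrier R" "\<beta> \<in> carrier R" "\<gamma> \<in> carrier R"
    and "f \<in> JB m \<rightarrow>\<^sub>E carrier R" "g \<in> JB m \<rightarrow>\<^sub>E carrier R" "c \<in> JB m"
    and "\<And>d1 d2. d1 \<in> JB m \<Longrightarrow> d2 \<in> JB m \<Longrightarrow> compose m d1 d2 = c \<Longrightarrow> f d1 = \<zero> \<or> g d2 = \<zero>"
  shows "(f \<otimes>\<^bsub>b_alg R m \<alpha> \<beta> \<gamma>\<^esub> g) c = \<zero>"
  unfolding b_mult_apply[OF assms(6)]
proof (rule add.finprod_one_eqI)
  fix p assume "p \<in> factorizations m c"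
  then have p: "fst p \<in> JB m" "snd p \<in> JB m" "compose m (fst p) (snd p) = c"
    by (auto simp: factorizations_def)
  then show "f (fst p) \<otimes> g (snd p) \<otimes> loop_factor R m \<alpha> \<beta> \<gamma> (fst p) (snd p) = \<zero>"
    by (intro b_term_zero assms)
qed

end

section \<open>The corner algebra\<close>

abbreviation north_cup :: "nat \<Rightarrow> vertex set" where
  "north_cup m \<equiv> {(North, m), (North, m + 1)}"

abbreviation south_cup :: "nat \<Rightarrow> vertex set" where
  "south_cup m \<equiv> {(South, m), (South, m + 1)}"

lemma compose_north_cup:
  assumes "m \<ge> 1" "north_cup m \<in> d1"
  shows "north_cup m \<in> compose m d1 d2"
proof (intro composeI connected_in_edge)
  have "upper ` north_cup m \<in> stack d1 d2"
    using assms(2) by (simp add: stack_def map_diagram_def del: image_insert)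
  then show "north_cup m \<in> stack d1 d2"
    by (simp add: upper_def)
qed (use assms(1) in \<open>auto simp: vertices_def\<close>)

lemma compose_south_cup:
  assumes "m \<ge> 1" "south_cup m \<in> d2"
  shows "south_cup m \<in> compose m d1 d2"
proof (intro composeI connected_in_edge)
  have "lower ` south_cup m \<in> stack d1 d2"
    using assms(2) by (simp add: stack_def map_diagram_def del: image_insert)
  then show "south_cup m \<in> stack d1 d2"
    by (simp add: lower_def)
qed (use assms(1) in \<open>auto simp: vertices_def\<close>)

lemma JBe_iff: "d \<in> JBe m \<longleftrightarrow> d \<in> JB m \<and> north_cup m \<in> d \<and> south_cup m \<in> d"
  by (simp add: JBe_def cup_cap_def)

text \<open>
  This turns out to be the carrier of the corner (\<open>carrier_corner\<close>).
\<close>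

definition span_JBe :: "('k, 'r) ring_scheme \<Rightarrow> nat \<Rightarrow> (diagram \<Rightarrow> 'k) set" where
  "span_JBe K m = {f \<in> JB m \<rightarrow>\<^sub>E carrier K. \<forall>d\<in>JB m - JBe m. f d = \<zero>\<^bsub>K\<^esub>}"

text \<open>
  The linear extension of \<open>rho m\<close> from the basis \<open>d / u\<close>. As the coefficient of \<open>f\<close> at the basis vector
  \<open>d / u\<close> is \<open>u * f d\<close>, the factor \<open>u\<close> appears here and not its inverse.
\<close>

definition rho_linear :: "('k, 'r) ring_scheme \<Rightarrow> nat \<Rightarrow> 'k \<Rightarrow> (diagram \<Rightarrow> 'k) \<Rightarrow> diagram \<Rightarrow> 'k" where
  "rho_linear K m u f = (\<lambda>c\<in>JB (m - 1). u \<otimes>\<^bsub>K\<^esub> f (add_cups m c))"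

lemma e_diagram_in_JBe: "m \<ge> 1 \<Longrightarrow> e_diagram m \<in> JBe m"
  by (simp only: e_diagram_eq_add_cups JBe_eq_add_cups imageI id_diagram_in_JB)

lemma rho_e_diagram: "m \<ge> 1 \<Longrightarrow> rho m (e_diagram m) = id_diagram (m - 1)"
  by (simp only: e_diagram_eq_add_cups rho_add_cups)

context cring
begin

lemma span_JBe_coeff_closed: "f \<in> span_JBe R m \<Longrightarrow> d \<in> JB m \<Longrightarrow> f d \<in> carrier R"
  by (auto simp: span_JBe_def)

text \<open>
  The extra factor \<open>\<beta>\<close> is the small white loop; \<open>\<beta>\<close> and \<open>\<gamma>\<close> are exchanged because the other loops
  across the centre line change colour.
\<close>

lemma loop_factor_add_cups:
  assumes "\<alpha> \<in> carrier R" "\<beta> \<in> carrier R" "\<gamma> \<in> carrier R"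
    and "m \<ge> 1" "c1 \<in> JB (m - 1)" "c2 \<in> JB (m - 1)"
  shows "loop_factor R m \<alpha> \<beta> \<gamma> (add_cups m c1) (add_cups m c2) =
    \<beta> \<otimes> loop_factor R (m - 1) \<alpha> \<gamma> \<beta> c1 c2"
  using assms(1-3) loops_pairs_add_cups[OF assms(4), of c1 c2]
    loops_white_add_cups[OF assms(4) assms(5,6)[THEN pairing_JB]]
    loops_black_add_cups[OF assms(4) assms(5,6)[THEN pairing_JB]]
  by (simp add: loop_factor_def m_ac nat_pow_Suc2)

lemma rho_linear_closed:
  assumes "m \<ge> 1" "u \<in> carrier R" "f \<in> span_JBe R m"
  shows "rho_linear R m u f \<in> JB (m - 1) \<rightarrow>\<^sub>E carrier R"
  using assms span_JBe_coeff_closed add_cups_in_JB_iff by (auto simp: rho_linear_def)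

text \<open>
  A product inherits the northern cup from its upper factor and the southern cap from its lower factor,
  so each factor has to supply only one of the two.
\<close>

lemma mult_in_span_JBe:
  assumes "\<alpha> \<in> carrier R" "\<beta> \<in> carrier R" "\<gamma> \<in> carrier R" "m \<ge> 1"
    and f: "f \<in> JB m \<rightarrow>\<^sub>E carrier R" "\<And>d. d \<in> JB m \<Longrightarrow> north_cup m \<notin> d \<Longrightarrow> f d = \<zero>"
    and g: "g \<in> JB m \<rightarrow>\<^sub>E carrier R" "\<And>d. d \<in> JB m \<Longrightarrow> south_cup m \<notin> d \<Longrightarrow> g d = \<zero>"
  shows "f \<otimes>\<^bsub>b_alg R m \<alpha> \<beta> \<gamma>\<^esub> g \<in> span_JBe R m"
proof -
  have "(f \<otimes>\<^bsub>b_alg R m \<alpha> \<beta> \<gamma>\<^esub> g) c = \<zero>" if c: "c \<in> JB m" "c \<notin> JBe m" for c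
  proof (rule b_mult_eq_zero[OF assms(1-3) f(1) g(1) c(1)])
    fix d1 d2 assume d: "d1 \<in> JB m" "d2 \<in> JB m" "compose m d1 d2 = c"
    have "north_cup m \<notin> d1 \<or> south_cup m \<notin> d2"
      using c d compose_north_cup[OF assms(4), of d1 d2] compose_south_cup[OF assms(4), of d2 d1]
      by (auto simp: JBe_iff)
    then show "f d1 = \<zero> \<or> g d2 = \<zero>"
      using d f(2) g(2) by blast
  qed
  then show ?thesis
    using b_mult_closed[OF assms(1-3) f(1) g(1)] by (simp add: span_JBe_def)
qed

text \<open>
  Factorisations of \<open>add_cups m c\<close> with both factors in \<open>JBe m\<close> correspond to factorisations of \<open>c\<close>, and
  the other ones contribute nothing. Each side then carries a factor \<open>\<beta>\<^sup>2\<close>: on the left one \<open>\<beta>\<close> comes from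
  \<open>rho_linear\<close> and one from the small loop, on the right both come from \<open>rho_linear\<close>.
\<close>

lemma rho_linear_mult:
  assumes "\<alpha> \<in> carrier R" "\<beta> \<in> carrier R" "\<gamma> \<in> carrier R" "m \<ge> 1"
    and f: "f \<in> span_JBe R m" and g: "g \<in> span_JBe R m"
  shows "rho_linear R m \<beta> (f \<otimes>\<^bsub>b_alg R m \<alpha> \<beta> \<gamma>\<^esub> g) =
    rho_linear R m \<beta> f \<otimes>\<^bsub>b_alg R (m - 1) \<alpha> \<gamma> \<beta>\<^esub> rho_linear R m \<beta> g"
    (is "?l = ?f \<otimes>\<^bsub>?B\<^esub> ?g")
proof (rule PiE_ext)
  note fun_f = f[unfolded span_JBe_def, THEN CollectD, THEN conjunct1]
  note fun_g = g[unfolded span_JBe_def, THEN CollectD, THEN conjunct1]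
  show "?l \<in> JB (m - 1) \<rightarrow>\<^sub>E carrier R"
    by (intro rho_linear_closed mult_in_span_JBe assms fun_f fun_g)
      (use f g in \<open>auto simp: span_JBe_def JBe_iff\<close>)
  show "?f \<otimes>\<^bsub>?B\<^esub> ?g \<in> JB (m - 1) \<rightarrow>\<^sub>E carrier R"
    by (intro b_mult_closed rho_linear_closed assms)
  fix c assume c: "c \<in> JB (m - 1)"
  let ?a = "add_cups m"
  let ?aa = "map_prod ?a ?a"
  let ?F = "\<lambda>p. f (fst p) \<otimes> g (snd p) \<otimes> loop_factor R m \<alpha> \<beta> \<gamma> (fst p) (snd p)"
  let ?G = "\<lambda>p. ?f (fst p) \<otimes> ?g (snd p) \<otimes> loop_factor R (m - 1) \<alpha> \<gamma> \<beta> (fst p) (snd p)"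
  have a: "?a c \<in> JB m"
    using c add_cups_in_JB_iff[OF assms(4)] by simp
  have F: "?F \<in> factorizations m (?a c) \<rightarrow> carrier R"
    by (intro b_term_closed assms fun_f fun_g)
  have sub: "?aa ` factorizations (m - 1) c \<subseteq> factorizations m (?a c)"
    using compose_add_cups[OF assms(4)] add_cups_in_JB_iff[OF assms(4)]
    by (auto simp: factorizations_def)
  \<comment> \<open>if both factors lie in \<open>JBe m\<close>, injectivity of \<open>add_cups m\<close> forces \<open>p\<close> into the image\<close>
  have zero: "?F p = \<zero>" if p: "p \<in> factorizations m (?a c) - ?aa ` factorizations (m - 1) c" for p
  proof -
    obtain d1 d2 where d: "p = (d1, d2)" "d1 \<in> JB m" "d2 \<in> JB m" "compose m d1 d2 = ?a c"
      using p by (auto simp: factorizations_def)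
    have "\<not> (d1 \<in> JBe m \<and> d2 \<in> JBe m)"
    proof
      assume "d1 \<in> JBe m \<and> d2 \<in> JBe m"
      then obtain c1 c2 where c12: "d1 = ?a c1" "d2 = ?a c2" "c1 \<in> JB (m - 1)" "c2 \<in> JB (m - 1)"
        unfolding JBe_eq_add_cups[OF assms(4)] by blast
      then have "(c1, c2) \<in> factorizations (m - 1) c"
        using d(4) compose_add_cups[OF assms(4)] by (simp add: factorizations_def)
      then have "p \<in> ?aa ` factorizations (m - 1) c"
        unfolding d(1) c12(1,2) by (rule map_prod_imageI)
      then show False
        using p by blast
    qed
    then have "f d1 = \<zero> \<or> g d2 = \<zero>"
      using d f g by (auto simp: span_JBe_def)
    then show ?thesis
      unfolding d(1) fst_conv snd_conv by (intro b_term_zero assms fun_f fun_g d)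
  qed
  have summand: "\<beta> \<otimes> ?F (?aa p) = ?G p" if p: "p \<in> factorizations (m - 1) c" for p
  proof -
    obtain c1 c2 where c12: "p = (c1, c2)" "c1 \<in> JB (m - 1)" "c2 \<in> JB (m - 1)"
      using p by (auto simp: factorizations_def)
    have "f (?a c1) \<in> carrier R" "g (?a c2) \<in> carrier R"
      using c12 span_JBe_coeff_closed f g add_cups_in_JB_iff[OF assms(4)] by blast+
    moreover have "loop_factor R (m - 1) \<alpha> \<gamma> \<beta> c1 c2 \<in> carrier R"
      by (intro loop_factor_closed assms)
    moreover have "loop_factor R m \<alpha> \<beta> \<gamma> (?a c1) (?a c2) = \<beta> \<otimes> loop_factor R (m - 1) \<alpha> \<gamma> \<beta> c1 c2"
      by (intro loop_factor_add_cups assms c12)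
    ultimately show ?thesis
      using c12 assms(1-3) by (simp add: rho_linear_def m_ac)
  qed
  have inj: "inj_on ?aa X" for X
    by (auto simp: inj_on_def)
  have F': "(\<lambda>p. ?F (?aa p)) \<in> factorizations (m - 1) c \<rightarrow> carrier R"
    using F sub by blast
  have "?l c = \<beta> \<otimes> finsum R ?F (factorizations m (?a c))"
    using c by (simp add: rho_linear_def b_mult_apply[OF a])
  also have "finsum R ?F (factorizations m (?a c)) = finsum R ?F (?aa ` factorizations (m - 1) c)"
    by (rule add.finprod_mono_neutral_cong_right) (use finite_factorizations sub zero F in auto)
  also have "\<dots> = (\<Oplus>p\<in>factorizations (m - 1) c. ?F (?aa p))"
    by (rule finsum_reindex) (use F sub inj in auto)
  also have "\<beta> \<otimes> \<dots> = (\<Oplus>p\<in>factorizations (m - 1) c. \<beta> \<otimes> ?F (?aa p))"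
    by (rule finsum_rdistr[OF finite_factorizations assms(2) F'])
  also have "\<dots> = finsum R ?G (factorizations (m - 1) c)"
    by (rule finsum_cong') (use summand b_term_closed rho_linear_closed assms in auto)
  also have "\<dots> = (?f \<otimes>\<^bsub>?B\<^esub> ?g) c"
    by (rule b_mult_apply[OF c, symmetric])
  finally show "?l c = (?f \<otimes>\<^bsub>?B\<^esub> ?g) c" .
qed

text \<open>
  Invertibility of \<open>u\<close> enters here: the inverse map puts \<open>inv u\<close> times the coefficient of \<open>rho m d\<close> at \<open>d\<close>
  and zero outside \<open>JBe m\<close>.
\<close>

lemma rho_linear_bij:
  assumes "m \<ge> 1" "u \<in> Units R"
  shows "bij_betw (rho_linear R m u) (span_JBe R m) (JB (m - 1) \<rightarrow>\<^sub>E carrier R)"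
proof -
  let ?ext = "\<lambda>g. \<lambda>d\<in>JB m. if d \<in> JBe m then inv u \<otimes> g (rho m d) else \<zero>"
  note u = Units_closed[OF assms(2)] Units_inv_closed[OF assms(2)]
  have cancel: "inv u \<otimes> (u \<otimes> x) = x" "u \<otimes> (inv u \<otimes> x) = x" if "x \<in> carrier R" for x
    using that u assms(2) by (simp_all add: m_assoc[symmetric])
  have JBe: "d \<in> JBe m \<Longrightarrow> rho m d \<in> JB (m - 1) \<and> add_cups m (rho m d) = d" for d
    by (auto simp: JBe_eq_add_cups[OF assms(1)])
  have add: "c \<in> JB (m - 1) \<Longrightarrow> add_cups m c \<in> JB m \<and> add_cups m c \<in> JBe m" for c
    by (simp add: JBe_eq_add_cups[OF assms(1)] add_cups_in_JB_iff[OF assms(1)])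
  show ?thesis
  proof (rule bij_betw_byWitness[where f' = ?ext])
    show "rho_linear R m u ` span_JBe R m \<subseteq> JB (m - 1) \<rightarrow>\<^sub>E carrier R"
      using rho_linear_closed[OF assms(1) u(1)] by blast
    show "?ext ` (JB (m - 1) \<rightarrow>\<^sub>E carrier R) \<subseteq> span_JBe R m"
    proof (rule image_subsetI)
      fix g assume g: "g \<in> JB (m - 1) \<rightarrow>\<^sub>E carrier R"
      have "?ext g d \<in> carrier R" if "d \<in> JB m" for d
        using JBe[of d] coeff_closed[OF g, of "rho m d"] u(2) that by simp
      then have "?ext g \<in> JB m \<rightarrow>\<^sub>E carrier R"
        by (intro PiE_I) simp_all
      then show "?ext g \<in> span_JBe R m"
        by (simp add: span_JBe_def)
    qed
    show "\<forall>f\<in>span_JBe R m. ?ext (rho_linear R m u f) = f"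
    proof
      fix f assume f: "f \<in> span_JBe R m"
      show "?ext (rho_linear R m u f) = f"
      proof
        fix d
        consider "d \<notin> JB m" | "d \<in> JB m" "d \<notin> JBe m" | "d \<in> JB m" "d \<in> JBe m" by blast
        then show "?ext (rho_linear R m u f) d = f d"
        proof cases
          case 1
          have "f \<in> JB m \<rightarrow>\<^sub>E carrier R"
            using f by (simp add: span_JBe_def)
          from PiE_arb[OF this 1] show ?thesis
            using 1 by simp
        next
          case 2
          then show ?thesis using f by (auto simp: span_JBe_def)
        next
          case 3
          then show ?thesis
            using JBe[OF 3(2)] span_JBe_coeff_closed[OF f 3(1)] cancel
            by (simp add: rho_linear_def)
        qed
      qed
    qed
    show "\<forall>g\<in>JB (m - 1) \<rightarrow>\<^sub>E carrier R. rho_linear R m u (?ext g) = g"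
    proof
      fix g assume g: "g \<in> JB (m - 1) \<rightarrow>\<^sub>E carrier R"
      show "rho_linear R m u (?ext g) = g"
      proof
        fix c
        show "rho_linear R m u (?ext g) c = g c"
          using g add[of c] coeff_closed[OF g, of c] cancel
          by (cases "c \<in> JB (m - 1)") (simp_all add: rho_linear_def PiE_arb[OF g])
      qed
    qed
  qed
qed

lemma scaled_basis_in_span_JBe:
  assumes "a \<in> carrier R" "d \<in> JBe m"
  shows "a \<odot>\<^bsub>b_alg R m \<alpha> \<beta> \<gamma>\<^esub> basis R m d \<in> span_JBe R m"
  using assms by (auto simp: span_JBe_def b_alg_simps basis_def)

lemma rho_linear_basis:
  assumes "m \<ge> 1" "u \<in> Units R" "d \<in> JBe m"
  shows "rho_linear R m u (inv u \<odot>\<^bsub>b_alg R m \<alpha> \<beta> \<gamma>\<^esub> basis R m d) = basis R (m - 1) (rho m d)"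
proof
  fix c
  obtain b where b: "d = add_cups m b"
    using assms(3) by (auto simp: JBe_eq_add_cups[OF assms(1)])
  show "rho_linear R m u (inv u \<odot>\<^bsub>b_alg R m \<alpha> \<beta> \<gamma>\<^esub> basis R m d) c = basis R (m - 1) (rho m d) c"
    using assms(2) Units_closed[OF assms(2)]
    by (simp add: rho_linear_def b_alg_simps basis_def b add_cups_in_JB_iff[OF assms(1)])
qed

text \<open>
  For \<open>f\<close> supported on \<open>JBe m\<close>, the equation \<open>f = e f e\<close> is not computed in the algebra itself but
  transported from the smaller one, where \<open>e\<close> becomes the identity diagram.
\<close>

lemma carrier_corner:
  assumes "\<alpha> \<in> carrier R" "\<beta> \<in> Units R" "\<gamma> \<in> carrier R" "m \<ge> 1"
  defines "A \<equiv> b_alg R m \<alpha> \<beta> \<gamma>"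
  defines "e \<equiv> inv \<beta> \<odot>\<^bsub>A\<^esub> basis R m (e_diagram m)"
  shows "carrier (corner A e) = span_JBe R m"
proof -
  let ?S = "span_JBe R m" and ?h = "rho_linear R m \<beta>" and ?B = "b_alg R (m - 1) \<alpha> \<gamma> \<beta>"
  have \<beta>: "\<beta> \<in> carrier R" "inv \<beta> \<in> carrier R"
    using assms(2) by auto
  note eJ = e_diagram_in_JBe[OF assms(4)]
  have S: "f \<in> JB m \<rightarrow>\<^sub>E carrier R" "\<And>d. d \<in> JB m \<Longrightarrow> north_cup m \<notin> d \<Longrightarrow> f d = \<zero>"
    "\<And>d. d \<in> JB m \<Longrightarrow> south_cup m \<notin> d \<Longrightarrow> f d = \<zero>" if "f \<in> ?S" for f
    using that by (auto simp: span_JBe_def JBe_iff)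
  have e: "e \<in> ?S"
    unfolding e_def A_def by (rule scaled_basis_in_span_JBe[OF \<beta>(2) eJ])
  have S_mult: "f \<otimes>\<^bsub>A\<^esub> g \<in> ?S" if "f \<in> ?S" "g \<in> ?S" for f g
    unfolding A_def using that by (intro mult_in_span_JBe assms \<beta>) (auto dest: S)
  \<comment> \<open>multiplying by \<open>e\<close> on the left creates the northern cup, on the right the southern cap\<close>
  have eAe: "(e \<otimes>\<^bsub>A\<^esub> x) \<otimes>\<^bsub>A\<^esub> e \<in> ?S" if x: "x \<in> JB m \<rightarrow>\<^sub>E carrier R" for x
  proof -
    have ex: "e \<otimes>\<^bsub>A\<^esub> x \<in> JB m \<rightarrow>\<^sub>E carrier R"
      unfolding A_def by (intro b_mult_closed assms \<beta> S(1)[OF e] x)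
    have "(e \<otimes>\<^bsub>A\<^esub> x) d = \<zero>" if d: "d \<in> JB m" "north_cup m \<notin> d" for d
      unfolding A_def
    proof (rule b_mult_eq_zero[OF assms(1) \<beta>(1) assms(3) S(1)[OF e] x d(1)])
      fix d1 d2 assume "d1 \<in> JB m" "d2 \<in> JB m" "compose m d1 d2 = d"
      then show "e d1 = \<zero> \<or> x d2 = \<zero>"
        using S(2)[OF e] d(2) compose_north_cup[OF assms(4)] by blast
    qed
    then show ?thesis
      using mult_in_span_JBe[OF assms(1) \<beta>(1) assms(3,4) ex _ S(1)[OF e] S(3)[OF e]]
      by (simp add: A_def)
  qed
  have h_e: "?h e = basis R (m - 1) (id_diagram (m - 1))"
    unfolding e_def A_def rho_linear_basis[OF assms(4,2) eJ]
    by (simp only: rho_e_diagram[OF assms(4)])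
  have h_mult: "?h (f \<otimes>\<^bsub>A\<^esub> g) = ?h f \<otimes>\<^bsub>?B\<^esub> ?h g" if "f \<in> ?S" "g \<in> ?S" for f g
    unfolding A_def using that by (intro rho_linear_mult assms \<beta>)
  \<comment> \<open>both sides have the same image under the injective map \<open>?h\<close>\<close>
  have unit: "(e \<otimes>\<^bsub>A\<^esub> f) \<otimes>\<^bsub>A\<^esub> e = f" if f: "f \<in> ?S" for f
  proof -
    have hf: "?h f \<in> JB (m - 1) \<rightarrow>\<^sub>E carrier R"
      by (rule rho_linear_closed[OF assms(4) \<beta>(1) f])
    have "?h ((e \<otimes>\<^bsub>A\<^esub> f) \<otimes>\<^bsub>A\<^esub> e) = (?h e \<otimes>\<^bsub>?B\<^esub> ?h f) \<otimes>\<^bsub>?B\<^esub> ?h e"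
      using e f S_mult by (simp add: h_mult)
    also have "\<dots> = ?h f"
      unfolding h_e using b_one_mult[OF assms(1,3) \<beta>(1) hf] b_mult_one[OF assms(1,3) \<beta>(1) hf] by simp
    finally show ?thesis
      using rho_linear_bij[OF assms(4,2)] e f S_mult
      by (meson bij_betw_imp_inj_on inj_onD)
  qed
  have "{e \<otimes>\<^bsub>A\<^esub> x \<otimes>\<^bsub>A\<^esub> e | x. x \<in> carrier A} = ?S"
  proof
    show "{e \<otimes>\<^bsub>A\<^esub> x \<otimes>\<^bsub>A\<^esub> e | x. x \<in> carrier A} \<subseteq> ?S"
      using eAe by (auto simp: A_def b_alg_simps)
    show "?S \<subseteq> {e \<otimes>\<^bsub>A\<^esub> x \<otimes>\<^bsub>A\<^esub> e | x. x \<in> carrier A}"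
    proof
      fix f assume f: "f \<in> ?S"
      have "f \<in> carrier A"
        using S(1)[OF f] by (simp add: A_def b_alg_simps)
      then show "f \<in> {e \<otimes>\<^bsub>A\<^esub> x \<otimes>\<^bsub>A\<^esub> e | x. x \<in> carrier A}"
        using unit[OF f] by force
    qed
  qed
  then show ?thesis
    by (simp add: corner_def)
qed

end

section \<open>The isomorphism\<close>

theorem proposition5p0p4:
  fixes K :: "('k, 'r) ring_scheme" and \<delta> \<delta>\<^sub>e \<kappa> :: 'k and m :: nat
  assumes "cring K"
    and "\<delta> \<in> carrier K" and "\<delta>\<^sub>e \<in> Units K" and "\<kappa> \<in> carrier K"
    and "m \<ge> 1"
  defines "A \<equiv> b_alg K m \<delta> \<delta>\<^sub>e \<kappa>"
  defines "B \<equiv> b_alg K (m - 1) \<delta> \<kappa> \<delta>\<^sub>e"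
  shows "\<exists>h \<in> algebra_iso K
             (corner A (inv\<^bsub>K\<^esub> \<delta>\<^sub>e \<odot>\<^bsub>A\<^esub> basis K m (e_diagram m))) B.
           \<forall>d\<in>JBe m. h (inv\<^bsub>K\<^esub> \<delta>\<^sub>e \<odot>\<^bsub>A\<^esub> basis K m d) = basis K (m - 1) (rho m d)"
proof -
  interpret cring K by (rule assms(1))
  let ?e = "inv\<^bsub>K\<^esub> \<delta>\<^sub>e \<odot>\<^bsub>A\<^esub> basis K m (e_diagram m)"
  let ?C = "corner A ?e" and ?h = "rho_linear K m \<delta>\<^sub>e"
  have \<delta>\<^sub>e: "\<delta>\<^sub>e \<in> carrier K"
    using assms(3) by auto
  have carrier_C: "carrier ?C = span_JBe K m"
    unfolding A_def by (rule carrier_corner[OF assms(2-5)])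
  have ops_C: "f \<otimes>\<^bsub>?C\<^esub> g = f \<otimes>\<^bsub>A\<^esub> g" "f \<oplus>\<^bsub>?C\<^esub> g = f \<oplus>\<^bsub>A\<^esub> g" "a \<odot>\<^bsub>?C\<^esub> f = a \<odot>\<^bsub>A\<^esub> f"
    "\<one>\<^bsub>?C\<^esub> = ?e" for f g a
    by (simp_all add: corner_def)
  have basis: "?h (inv\<^bsub>K\<^esub> \<delta>\<^sub>e \<odot>\<^bsub>A\<^esub> basis K m d) = basis K (m - 1) (rho m d)" if "d \<in> JBe m" for d
    unfolding A_def by (rule rho_linear_basis[OF assms(5,3) that])
  have add_in_JB: "c \<in> JB (m - 1) \<Longrightarrow> add_cups m c \<in> JB m" for c
    using add_cups_in_JB_iff[OF assms(5)] by simp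
  have "?h \<in> ring_hom ?C B"
  proof (rule ring_hom_memI)
    show "?h f \<in> carrier B" if "f \<in> carrier ?C" for f
      using rho_linear_closed[OF assms(5) \<delta>\<^sub>e] that by (simp add: carrier_C B_def b_alg_simps)
    show "?h (f \<otimes>\<^bsub>?C\<^esub> g) = ?h f \<otimes>\<^bsub>B\<^esub> ?h g" if "f \<in> carrier ?C" "g \<in> carrier ?C" for f g
      unfolding ops_C unfolding A_def B_def
      using that unfolding carrier_C by (intro rho_linear_mult assms \<delta>\<^sub>e)
    show "?h (f \<oplus>\<^bsub>?C\<^esub> g) = ?h f \<oplus>\<^bsub>B\<^esub> ?h g" if "f \<in> carrier ?C" "g \<in> carrier ?C" for f g
    proof
      fix c
      show "?h (f \<oplus>\<^bsub>?C\<^esub> g) c = (?h f \<oplus>\<^bsub>B\<^esub> ?h g) c"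
        using that \<delta>\<^sub>e add_in_JB[of c] span_JBe_coeff_closed[of _ m "add_cups m c"]
        unfolding ops_C carrier_C unfolding A_def B_def b_alg_simps
        by (simp add: rho_linear_def r_distr)
    qed
    show "?h \<one>\<^bsub>?C\<^esub> = \<one>\<^bsub>B\<^esub>"
      unfolding ops_C basis[OF e_diagram_in_JBe[OF assms(5)]] rho_e_diagram[OF assms(5)]
      by (simp only: B_def b_alg_simps)
  qed
  moreover have "bij_betw ?h (carrier ?C) (carrier B)"
    using rho_linear_bij[OF assms(5,3)] by (simp add: carrier_C B_def b_alg_simps)
  moreover have "?h (a \<odot>\<^bsub>?C\<^esub> f) = a \<odot>\<^bsub>B\<^esub> ?h f" if "a \<in> carrier K" "f \<in> carrier ?C" for a f
  proof
    fix c
    show "?h (a \<odot>\<^bsub>?C\<^esub> f) c = (a \<odot>\<^bsub>B\<^esub> ?h f) c"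
      using that \<delta>\<^sub>e add_in_JB[of c] span_JBe_coeff_closed[of f m "add_cups m c"]
      unfolding ops_C carrier_C unfolding A_def B_def b_alg_simps
      by (simp add: rho_linear_def m_lcomm)
  qed
  ultimately have "?h \<in> algebra_iso K ?C B"
    by (simp add: algebra_iso_def ring_iso_def)
  then show ?thesis
    using basis by blast
qed

end
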